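(* Let $n\in\mathbb{N}$, $n\ge 1$, and let $B_m$, $\alpha_j$, $r_j$, $J_r$, $J_{1/r}$, $c_r$, $c_{1/r}$, the functions $\phi_n^\pm$ and $\psi^\pm_{t_1,\ldots,t_n}$, and the operators $S_\epsilon^{\pm m}$, $R_\upsilon^{\pm m}$ be as defined in the context. Put $$\beta_n:=2^n\sqrt{\alpha_1r_1\cdots\alpha_nr_n},\qquad \widetilde\gamma_n:=\frac{2^n\sqrt{\alpha_1\cdots\alpha_n}\,(r_1\cdots r_n)}{(-1)^{n+1}},\qquad \delta_n:=\prod_{j=1}^n\Bigl(\frac1{r_j}-r_j\Bigr).$$ Fix a choice of sign, i.e. read either all upper signs or all lower signs throughout. Then the following hold. (1) For every choice $t_j\in\{r_j,1/r_j\}$, $j=1,\ldots,n$, and the corresponding function $\phi_n^\pm$, $$\Phi_n(x):=\Bigl(S_{c_r}^{\pm1}\cdots S_1^{\pm1}\bigl[R_{c_{1/r}}^{\mp1}\cdots R_1^{\mp1}\phi_n^\pm\bigr]\Bigr)(x)=\beta_n\,B_n(x),\qquad x\in\mathbb{R}.$$ (2) For each $(t_1,\ldots,t_n)$ with $t_j\in\{r_j,1/r_j\}$ define $$\Lambda^\pm_{t_1,\ldots,t_n}(x):=\Bigl(S_{c_r}^{\mp1}S_{c_r}^{\pm1/2}\cdots S_1^{\mp1}S_1^{\pm1/2}\bigl[R_{c_{1/r}}^{\pm1}R_{c_{1/r}}^{\mp1/2}\cdots R_1^{\pm1}R_1^{\mp1/2}\psi^\pm_{t_1,\ldots,t_n}\bigr]\Bigr)(x),$$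 and define recursively $T^0_{t_1,\ldots,t_n}:=\Lambda^\pm_{t_1,\ldots,t_n}$ and, for $j=1,\ldots,n$, $$T^j_{t_{j+1},\ldots,t_n}:=\frac1{\sqrt{r_j}}\,T^{j-1}_{r_j,t_{j+1},\ldots,t_n}-\sqrt{r_j}\,T^{j-1}_{1/r_j,t_{j+1},\ldots,t_n},\qquad \Psi_n:=T^n .$$ Equivalently, $\Psi_n=\sum_{(t_1,\ldots,t_n)}\Bigl(\prod_{j:\,t_j=r_j}\frac{1}{\sqrt{r_j}}\Bigr)\Bigl(\prod_{j:\,t_j=1/r_j}(-\sqrt{r_j})\Bigr)\Lambda^\pm_{t_1,\ldots,t_n}$, the sum being over all $2^n$ choices $t_j\in\{r_j,1/r_j\}$. Then $$\Psi_n(x)=\frac{\delta_n\,\widetilde\gamma_n}{2^{2n+1}}\;\frac{d^{\,n+1}}{dx^{\,n+1}}\Bigl[B_{2n+1}(2x+n)\Bigr],\qquad x\in\mathbb{R}.$$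
   Context: Fourier transform: $\hat f(\omega)=\int_{\mathbb{R}}f(x)\mathrm{e}^{-i\omega x}\,dx$. B-splines: $B_0=\chi_{[0,1)}$ and $B_m(x)=\int_0^1B_{m-1}(x-t)\,dt$ for $m\ge1$. Numbers $\alpha_j$, $r_j$: for $n\ge1$ let $\mathbb{P}_n(\omega):=\sum_{m\in\mathbb{Z}}|\hat B_n(\omega+2\pi m)|^2$. There are real numbers $\alpha_1,\ldots,\alpha_n>1$, pairwise distinct, such that $$\mathbb{P}_n(\omega)=\prod_{j=1}^n\Bigl(1-\frac{\sin^2(\omega/2)}{\alpha_j}\Bigr).$$ (Equivalently: with $U_0(z)=1$ and $U_{m+1}(z)=zU_m(z)+\frac1{m+2}(1-z^2)U_m'(z)$ one has $\mathbb{P}_n(\omega)=U_{2n}(\cos(\omega/2))$, and $\alpha_1,\ldots,\alpha_n$ are the zeros of $U_{2n}(z)$ written as a polynomial in $y=1-z^2$.) Fix an enumeration of them and put $$r_j:=(2\alpha_j-1)-2\sqrt{\alpha_j(\alpha_j-1)}\in(0,1).$$ Choices: given $t_j\in\{r_j,1/r_j\}$ for $j=1,\ldots,n$, let $J_r:=\{j:t_j=r_j\}=\{j_1,\ldots,j_{c_r}\}$ and $J_{1/r}:=\{j:t_j=1/r_j\}=\{\iota_1,\ldots,\iota_{c_{1/r}}\}$, with cardinalities $c_r$ and $c_{1/r}$, so $c_r+c_{1/r}=n$. Battle--Lemarié type scaling functions and wavelets (already shifted so as to be centred; upper or lower signs are read consistently): for given $t_1,\ldots,t_n$, $\phi_n^\pm$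 and $\psi^\pm_{t_1,\ldots,t_n}$ are the continuous functions in $L^2(\mathbb{R})$ with $$\hat\phi_n^\pm(\omega)=\frac{2^n\sqrt{\alpha_1r_1\cdots\alpha_nr_n}\;\hat B_n(\omega)}{\prod_{j\in J_r}(\mathrm{e}^{\pm i\omega}r_j+1)\,\prod_{\iota\in J_{1/r}}(\mathrm{e}^{\mp i\omega}r_\iota+1)},$$ $$\hat\psi^\pm_{t_1,\ldots,t_n}(\omega)=\frac{(-1)^{n+1}\sqrt{\alpha_1t_1\cdots\alpha_nt_n}\,(r_1\cdots r_n)}{2}\cdot\frac{\prod_{j=1}^n\bigl(1/t_j-\mathrm{e}^{\mp i\omega/2}\bigr)\;\sum_{k=0}^{n+1}(-1)^k\binom{n+1}{k}\mathrm{e}^{(n-k)i\omega/2}\;\hat B_n(\omega/2)}{\prod_{j\in J_r}(1+r_j\mathrm{e}^{\mp i\omega})(1+r_j\mathrm{e}^{\pm i\omega/2})\;\prod_{\iota\in J_{1/r}}(1+r_\iota\mathrm{e}^{\pm i\omega})(1+r_\iota\mathrm{e}^{\mp i\omega/2})}.$$ Operators: for a function $F$ on $\mathbb{R}$ and $m>0$ with $2m\in\mathbb{N}$, $$(S_\epsilon^{\pm m}F)(x):=F(x)+r_{j_\epsilon}F(x\pm m),\quad 1\le\epsilon\le c_r;\qquad (R_\upsilon^{\pm m}F)(x):=F(x)+r_{\iota_\upsilon}F(x\pm m),\quad 1\le\upsilon\le c_{1/r}.$$ Products of such operators are compositions (they commute); an empty composition is the identity. *)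

theory Defs
  imports "HOL-Analysis.Analysis"
begin

definition fourier :: "(real \<Rightarrow> complex) \<Rightarrow> real \<Rightarrow> complex" where
  "fourier f \<omega> = (LBINT x. f x * exp (- (\<i> * of_real (\<omega> * x))))"

definition square_integrable :: "(real \<Rightarrow> complex) \<Rightarrow> bool" where
  "square_integrable f \<longleftrightarrow>
     f \<in> borel_measurable lborel \<and> integrable lborel (\<lambda>x. (norm (f x))\<^sup>2)"

text \<open>
  Functions in \<open>L\<^sup>2\<close> need not be integrable, so their Fourier transform is the Plancherel one:
  the limit in \<open>L\<^sup>2\<close> of the transforms of the truncations to \<open>[-R, R]\<close>. The nonnegative integral is
  used so that no convention about non-integrable functions can enter.
\<close>

definition has_L2_fourier :: "(real \<Rightarrow> complex) \<Rightarrow> (real \<Rightarrow> complex) \<Rightarrow> bool" where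
  "has_L2_fourier f g \<longleftrightarrow>
     ((\<lambda>R::real. \<integral>\<^sup>+ \<omega>. ennreal ((norm (g \<omega>
          - fourier (\<lambda>x. indicator {- R..R} x * f x) \<omega>))\<^sup>2) \<partial>lborel)
        \<longlongrightarrow> 0) at_top"

definition continuous_L2_with_fourier :: "(real \<Rightarrow> complex) \<Rightarrow> (real \<Rightarrow> complex) \<Rightarrow> bool" where
  "continuous_L2_with_fourier f g \<longleftrightarrow>
     continuous_on UNIV f \<and> square_integrable f \<and> has_L2_fourier f g"

primrec bspline :: "nat \<Rightarrow> real \<Rightarrow> real" where
  "bspline 0 = (\<lambda>x. indicator {0..<1} x)"
| "bspline (Suc m) = (\<lambda>x. LBINT t:{0..1}. bspline m (x - t))"

definition bspline_hat :: "nat \<Rightarrow> real \<Rightarrow> complex" where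
  "bspline_hat m = fourier (\<lambda>x. of_real (bspline m x))"

definition P_sum :: "nat \<Rightarrow> real \<Rightarrow> real" where
  "P_sum n \<omega> = (\<Sum>\<^sub>\<infinity>m\<in>(UNIV::int set). (norm (bspline_hat n (\<omega> + 2 * pi * of_int m)))\<^sup>2)"

text \<open>\<open>\<alpha> 1, \<dots>, \<alpha> n\<close> is an enumeration of the numbers \<open>\<alpha>\<^sub>j\<close>; other values of \<open>\<alpha>\<close> are irrelevant.\<close>

definition alpha_enumeration :: "nat \<Rightarrow> (nat \<Rightarrow> real) \<Rightarrow> bool" where
  "alpha_enumeration n \<alpha> \<longleftrightarrow>
     (\<forall>j\<in>{1..n}. \<alpha> j > 1) \<and> inj_on \<alpha> {1..n} \<and>
     (\<forall>\<omega>. P_sum n \<omega> = (\<Prod>j=1..n. 1 - (sin (\<omega> / 2))\<^sup>2 / \<alpha> j))"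

definition r_of :: "(nat \<Rightarrow> real) \<Rightarrow> nat \<Rightarrow> real" where
  "r_of \<alpha> j = (2 * \<alpha> j - 1) - 2 * sqrt (\<alpha> j * (\<alpha> j - 1))"

text \<open>
  A tuple \<open>(t\<^sub>1, \<dots>, t\<^sub>n)\<close> is a function that is \<^term>\<open>undefined\<close> outside \<open>{1..n}\<close>, so that
  there is exactly one such function per tuple.
\<close>

definition choices :: "nat \<Rightarrow> (nat \<Rightarrow> real) \<Rightarrow> (nat \<Rightarrow> real) set" where
  "choices n r = (\<Pi>\<^sub>E j\<in>{1..n}. {r j, 1 / r j})"

definition J_r :: "nat \<Rightarrow> (nat \<Rightarrow> real) \<Rightarrow> (nat \<Rightarrow> real) \<Rightarrow> nat set" where
  "J_r n r t = {j\<in>{1..n}. t j = r j}"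

definition J_inv :: "nat \<Rightarrow> (nat \<Rightarrow> real) \<Rightarrow> (nat \<Rightarrow> real) \<Rightarrow> nat set" where
  "J_inv n r t = {j\<in>{1..n}. t j = 1 / r j}"

text \<open>From here on \<open>s\<close> is the choice of sign: \<open>1\<close> for the upper and \<open>-1\<close> for the lower signs.\<close>

definition phi_hat :: "nat \<Rightarrow> (nat \<Rightarrow> real) \<Rightarrow> real \<Rightarrow> (nat \<Rightarrow> real) \<Rightarrow> real \<Rightarrow> complex" where
  "phi_hat n \<alpha> s t \<omega> = (let r = r_of \<alpha> in
     of_real (2 ^ n * sqrt (\<Prod>j=1..n. \<alpha> j * r j)) * bspline_hat n \<omega> /
     ((\<Prod>j\<in>J_r n r t. exp (\<i> * of_real (s * \<omega>)) * of_real (r j) + 1) *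
      (\<Prod>j\<in>J_inv n r t. exp (- (\<i> * of_real (s * \<omega>))) * of_real (r j) + 1)))"

definition psi_hat :: "nat \<Rightarrow> (nat \<Rightarrow> real) \<Rightarrow> real \<Rightarrow> (nat \<Rightarrow> real) \<Rightarrow> real \<Rightarrow> complex" where
  "psi_hat n \<alpha> s t \<omega> = (let r = r_of \<alpha> in
     of_real ((-1) ^ (n + 1) * sqrt (\<Prod>j=1..n. \<alpha> j * t j) * (\<Prod>j=1..n. r j) / 2) *
     (((\<Prod>j=1..n. of_real (1 / t j) - exp (- (\<i> * of_real (s * \<omega> / 2)))) *
       (\<Sum>k=0..n+1. (-1) ^ k * of_nat ((n + 1) choose k) *
          exp (of_real (real n - real k) * \<i> * of_real (\<omega> / 2))) *
       bspline_hat n (\<omega> / 2)) /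
      ((\<Prod>j\<in>J_r n r t. (1 + of_real (r j) * exp (- (\<i> * of_real (s * \<omega>)))) *
                       (1 + of_real (r j) * exp (\<i> * of_real (s * \<omega> / 2)))) *
       (\<Prod>j\<in>J_inv n r t. (1 + of_real (r j) * exp (\<i> * of_real (s * \<omega>))) *
                         (1 + of_real (r j) * exp (- (\<i> * of_real (s * \<omega> / 2))))))))"

definition scaling_function ::
    "nat \<Rightarrow> (nat \<Rightarrow> real) \<Rightarrow> real \<Rightarrow> (nat \<Rightarrow> real) \<Rightarrow> (real \<Rightarrow> complex) \<Rightarrow> bool" where
  "scaling_function n \<alpha> s t \<phi> \<longleftrightarrow> continuous_L2_with_fourier \<phi> (phi_hat n \<alpha> s t)"

definition wavelet ::
    "nat \<Rightarrow> (nat \<Rightarrow> real) \<Rightarrow> real \<Rightarrow> (nat \<Rightarrow> real) \<Rightarrow> (real \<Rightarrow> complex) \<Rightarrow> bool" where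
  "wavelet n \<alpha> s t \<psi> \<longleftrightarrow> continuous_L2_with_fourier \<psi> (psi_hat n \<alpha> s t)"

text \<open>
  With \<open>j\<^sub>\<epsilon>\<close> the \<open>\<epsilon>\<close>-th element of \<^const>\<open>J_r\<close>, the operator \<open>S\<^sub>\<epsilon>\<close> with shift \<open>h\<close> is
  \<open>shift_op (r j\<^sub>\<epsilon>) h\<close>; likewise for \<open>R\<^sub>\<upsilon>\<close> and \<^const>\<open>J_inv\<close>. Both index sets are enumerated
  increasingly. Since \<open>fold f [x\<^sub>1, \<dots>, x\<^sub>c] = f x\<^sub>c \<circ> \<dots> \<circ> f x\<^sub>1\<close>, the operator with index 1 acts first.
\<close>

definition shift_op :: "real \<Rightarrow> real \<Rightarrow> (real \<Rightarrow> complex) \<Rightarrow> real \<Rightarrow> complex" where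
  "shift_op a h F = (\<lambda>x. F x + of_real a * F (x + h))"

definition Phi ::
    "nat \<Rightarrow> (nat \<Rightarrow> real) \<Rightarrow> real \<Rightarrow> (nat \<Rightarrow> real) \<Rightarrow> (real \<Rightarrow> complex) \<Rightarrow> real \<Rightarrow> complex" where
  "Phi n r s t \<phi> =
     fold (\<lambda>j. shift_op (r j) s) (sorted_list_of_set (J_r n r t))
       (fold (\<lambda>j. shift_op (r j) (- s)) (sorted_list_of_set (J_inv n r t)) \<phi>)"

definition Lam ::
    "nat \<Rightarrow> (nat \<Rightarrow> real) \<Rightarrow> real \<Rightarrow> (nat \<Rightarrow> real) \<Rightarrow> (real \<Rightarrow> complex) \<Rightarrow> real \<Rightarrow> complex" where
  "Lam n r s t \<psi> =
     fold (\<lambda>j. shift_op (r j) (- s) \<circ> shift_op (r j) (s / 2)) (sorted_list_of_set (J_r n r t))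
       (fold (\<lambda>j. shift_op (r j) s \<circ> shift_op (r j) (- s / 2)) (sorted_list_of_set (J_inv n r t)) \<psi>)"

text \<open>
  \<open>T_rec r L j t\<close> is \<open>T\<^sup>j\<close> with index \<open>(t\<^sub>j\<^sub>+\<^sub>1, \<dots>, t\<^sub>n)\<close>, a function that is \<^term>\<open>undefined\<close>
  outside \<open>{j+1..n}\<close>; \<open>L t\<close> is the initial family. For \<open>j = n\<close> the index is the empty tuple, that is,
  the function that is \<^term>\<open>undefined\<close> everywhere.
\<close>

primrec T_rec ::
    "(nat \<Rightarrow> real) \<Rightarrow> ((nat \<Rightarrow> real) \<Rightarrow> real \<Rightarrow> complex) \<Rightarrow> nat \<Rightarrow> (nat \<Rightarrow> real) \<Rightarrow> real \<Rightarrow> complex" where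
  "T_rec r L 0 t = L t"
| "T_rec r L (Suc j) t = (\<lambda>x.
     of_real (1 / sqrt (r (Suc j))) * T_rec r L j (t(Suc j := r (Suc j))) x
     - of_real (sqrt (r (Suc j))) * T_rec r L j (t(Suc j := 1 / r (Suc j))) x)"

definition Psi ::
    "nat \<Rightarrow> (nat \<Rightarrow> real) \<Rightarrow> real \<Rightarrow> ((nat \<Rightarrow> real) \<Rightarrow> real \<Rightarrow> complex) \<Rightarrow> real \<Rightarrow> complex" where
  "Psi n r s \<psi> = T_rec r (\<lambda>t. Lam n r s t (\<psi> t)) n (\<lambda>_. undefined)"

definition beta_const :: "nat \<Rightarrow> (nat \<Rightarrow> real) \<Rightarrow> real" where
  "beta_const n \<alpha> = 2 ^ n * sqrt (\<Prod>j=1..n. \<alpha> j * r_of \<alpha> j)"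

definition gamma_tilde :: "nat \<Rightarrow> (nat \<Rightarrow> real) \<Rightarrow> real" where
  "gamma_tilde n \<alpha> = 2 ^ n * sqrt (\<Prod>j=1..n. \<alpha> j) * (\<Prod>j=1..n. r_of \<alpha> j) / (-1) ^ (n + 1)"

definition delta_const :: "nat \<Rightarrow> (nat \<Rightarrow> real) \<Rightarrow> real" where
  "delta_const n \<alpha> = (\<Prod>j=1..n. 1 / r_of \<alpha> j - r_of \<alpha> j)"

end

theory Submission
  imports Defs "HOL-Probability.Characteristic_Functions" "HOL-Real_Asymp.Real_Asymp"
begin

text \<open>
  On the Fourier side the shift operators are multiplications by trigonometric factors which
  cancel exactly the denominators of the transforms of \<open>\<phi>\<close> and \<open>\<psi>\<close>. In the weighted sum over
  all choices, the weight of \<open>t\<^sub>j\<close> combines with \<open>\<surd>t\<^sub>j\<close> into a sign, so the sum over choices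
  factors into \<open>\<Prod>\<^sub>j ((1/r\<^sub>j - z) - (r\<^sub>j - z))\<close>, which no longer
  depends on \<open>z = exp (-i s \<omega> / 2)\<close>. What is left is
  the transform of an \<open>(n+1)\<close>-st backward difference of \<open>B\<^sub>n\<close>, that is, of a derivative of
  \<open>B\<^sub>2\<^sub>n\<^sub>+\<^sub>1\<close>. Everything is a statement about continuous functions, hence it remains
  to know that a continuous function is determined by its \<open>L\<^sup>2\<close> Fourier transform. Plancherel's
  theorem is avoided: Fourier pairs enter only through their Gaussian averages, a relation
  that is linear, compatible with shifts, implied by \<open>L\<^sup>2\<close> convergence of the truncated
  transforms, and, since Gaussians are an approximate identity, still determines the function.
\<close>

subsection \<open>Gaussian averages\<close>

lemma borel_measurable_cis [measurable]: "cis \<in> borel_measurable borel"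
  by (intro borel_measurable_continuous_onI continuous_intros)

lemma fourier_cis: "fourier f \<omega> = (LBINT x. f x * cis (- (\<omega> * x)))"
  by (simp add: fourier_def cis_conv_exp)

lemma exp_minus_i_cis: "exp (- (\<i> * of_real x)) = cis (- x)"
  by (simp add: cis_conv_exp)

section \<open>Gaussian integrals and Fourier transforms against Gaussian weights\<close>

lemma integrable_gaussian:
  assumes "a > 0"
  shows "integrable lborel (\<lambda>x::real. exp (- (a * (x - y)\<^sup>2)))"
proof -
  \<comment> \<open>With variance \<open>1 / (2 * a)\<close> the exponent of the normal density
    becomes \<open>a * (x - y)^2\<close>.\<close>
  define \<sigma> where "\<sigma> = sqrt (1 / (2 * a))"
  have s: "\<sigma>\<^sup>2 = 1 / (2 * a)" using assms by (simp add: \<sigma>_def)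
  have "integrable lborel (\<lambda>x. sqrt (2 * pi * \<sigma>\<^sup>2) * normal_density y \<sigma> x)"
    using assms by (intro integrable_mult_right integrable_normal_density) (simp add: \<sigma>_def)
  moreover have "sqrt (2 * pi * \<sigma>\<^sup>2) * normal_density y \<sigma> x = exp (- (a * (x - y)\<^sup>2))" for x
    using assms unfolding normal_density_def s by (simp add: field_simps)
  ultimately show ?thesis by simp
qed

lemma integral_gaussian:
  assumes "a > 0"
  shows "(LBINT x::real. exp (- (a * x\<^sup>2))) = sqrt (pi / a)"
proof -
  define \<sigma> where "\<sigma> = sqrt (1 / (2 * a))"
  have s: "\<sigma>\<^sup>2 = 1 / (2 * a)" using assms by (simp add: \<sigma>_def)
  have s0: "\<sigma> > 0" using assms by (simp add: \<sigma>_def)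
  have "(LBINT x. sqrt (2 * pi * \<sigma>\<^sup>2) * normal_density 0 \<sigma> x) = sqrt (2 * pi * \<sigma>\<^sup>2)"
    using s0 by (subst integral_mult_right_zero) (simp add: integral_normal_density)
  moreover have "sqrt (2 * pi * \<sigma>\<^sup>2) * normal_density 0 \<sigma> x = exp (- (a * x\<^sup>2))" for x
    using assms unfolding normal_density_def s by (simp add: field_simps)
  moreover have "sqrt (2 * pi * \<sigma>\<^sup>2) = sqrt (pi / a)" by (simp add: s)
  ultimately show ?thesis by (simp only:)
qed

text \<open>Scaling by \<open>c = sqrt (2 * a)\<close> turns the weight into a multiple of the
  standard normal density, whose characteristic function is known.\<close>

lemma fourier_gaussian:
  assumes "a > 0"
  shows "(LBINT \<omega>. exp (- (a * \<omega>\<^sup>2)) *\<^sub>R cis (\<omega> * y)) = of_real (sqrt (pi / a) * exp (- (y\<^sup>2 / (4 * a))))"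
proof -
  define c where "c = sqrt (2 * a)"
  have c: "c > 0" "c\<^sup>2 = 2 * a" using assms by (simp_all add: c_def)
  have "(LBINT x. std_normal_density x *\<^sub>R cis (y / c * x)) = char std_normal_distribution (y / c)"
    unfolding char_def by (subst integral_density) (simp_all add: cis_conv_exp)
  also have "\<dots> = of_real (exp (- (y\<^sup>2 / (4 * a))))"
    using c by (simp add: char_std_normal_distribution power_divide)
  finally have *: "(LBINT x. std_normal_density x *\<^sub>R cis (y / c * x)) = of_real (exp (- (y\<^sup>2 / (4 * a))))" .
  have "(LBINT x. std_normal_density x *\<^sub>R cis (y / c * x)) =
      c *\<^sub>R (LBINT x. std_normal_density (c * x) *\<^sub>R cis (x * y))"
    using c by (subst lborel_integral_real_affine[of c _ 0]) (simp_all add: mult.commute)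
  also have "\<And>x. std_normal_density (c * x) = (1 / sqrt (2 * pi)) * exp (- (a * x\<^sup>2))"
    using c by (simp add: std_normal_density_def power_mult_distrib)
  then have "(LBINT x. std_normal_density (c * x) *\<^sub>R cis (x * y)) =
     (1 / sqrt (2 * pi)) *\<^sub>R (LBINT x. exp (- (a * x\<^sup>2)) *\<^sub>R cis (x * y))"
    by (simp only: scaleR_scaleR[symmetric] integral_scaleR_right)
  finally have **: "(LBINT \<omega>. exp (- (a * \<omega>\<^sup>2)) *\<^sub>R cis (\<omega> * y)) =
      (sqrt (2 * pi) / c) *\<^sub>R of_real (exp (- (y\<^sup>2 / (4 * a))))"
    using c unfolding * by simp
  have "sqrt (2 * pi) / c = sqrt (pi / a)"
    using assms by (simp add: c_def real_sqrt_divide[symmetric])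
  then show ?thesis unfolding ** by (simp add: scaleR_conv_of_real)
qed

lemma borel_measurable_fourier [measurable]:
  assumes [measurable]: "f \<in> borel_measurable borel"
  shows "fourier f \<in> borel_measurable borel"
  unfolding fourier_cis[abs_def] by measurable

lemma norm_fourier_le: "norm (fourier f \<omega>) \<le> (LBINT x. norm (f x))"
  unfolding fourier_cis by (rule order_trans[OF integral_norm_bound]) (simp add: norm_mult)

text \<open>Fubini for the kernel \<open>k\<close>, whose integral over \<open>\<omega>\<close> is
  the transform of a Gaussian. The weight makes \<open>k\<close> absolutely integrable on the plane
  although \<open>fourier f\<close> itself need not be integrable; this weighted identity stands in
  for Fourier inversion.\<close>

lemma fourier_gaussian_duality:
  assumes f: "integrable lborel f" and a: "a > 0"
  shows "(LBINT \<omega>. exp (- (a * \<omega>\<^sup>2)) *\<^sub>R (cis (\<omega> * y) * fourier f \<omega>)) =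
         sqrt (pi / a) *\<^sub>R (LBINT x. exp (- ((x - y)\<^sup>2 / (4 * a))) *\<^sub>R f x)"
proof -
  have [measurable]: "f \<in> borel_measurable borel" using f by auto
  define k where "k = (\<lambda>x \<omega>. exp (- (a * \<omega>\<^sup>2)) *\<^sub>R (f x * cis (\<omega> * (y - x))))"
  have g: "integrable lborel (\<lambda>\<omega>. exp (- (a * \<omega>\<^sup>2)))"
    using integrable_gaussian[OF a, of 0] by simp
  have nk: "norm (k x \<omega>) = exp (- (a * \<omega>\<^sup>2)) * norm (f x)" for x \<omega>
    by (simp add: k_def norm_mult)
  have int: "integrable (lborel \<Otimes>\<^sub>M lborel) (case_prod k)"
  proof (rule lborel_pair.Fubini_integrable)
    show "case_prod k \<in> borel_measurable (lborel \<Otimes>\<^sub>M lborel)"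
      unfolding k_def by measurable
    show "integrable lborel (\<lambda>x. LBINT \<omega>. norm (case_prod k (x, \<omega>)))"
      using f by (simp add: nk)
    show "AE x in lborel. integrable lborel (\<lambda>\<omega>. case_prod k (x, \<omega>))"
    proof (rule AE_I2)
      fix x
      have "integrable lborel (\<lambda>\<omega>. exp (- (a * \<omega>\<^sup>2)) * norm (f x))" using g by simp
      then show "integrable lborel (\<lambda>\<omega>. case_prod k (x, \<omega>))"
        by (rule Bochner_Integration.integrable_bound) (auto simp: nk, simp add: k_def)
    qed
  qed
  have "(LBINT \<omega>. exp (- (a * \<omega>\<^sup>2)) *\<^sub>R (cis (\<omega> * y) * fourier f \<omega>)) = (LBINT \<omega>. LBINT x. k x \<omega>)"
  proof (rule Bochner_Integration.integral_cong)
    fix \<omega>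
    have "(LBINT x. k x \<omega>) = (LBINT x. exp (- (a * \<omega>\<^sup>2)) *\<^sub>R (cis (\<omega> * y) * (f x * cis (- (\<omega> * x)))))"
    proof (rule Bochner_Integration.integral_cong)
      fix x
      have "cis (\<omega> * (y - x)) = cis (\<omega> * y) * cis (- (\<omega> * x))"
        by (simp add: cis_mult algebra_simps)
      then show "k x \<omega> = exp (- (a * \<omega>\<^sup>2)) *\<^sub>R (cis (\<omega> * y) * (f x * cis (- (\<omega> * x))))"
        by (simp add: k_def)
    qed simp
    then show "exp (- (a * \<omega>\<^sup>2)) *\<^sub>R (cis (\<omega> * y) * fourier f \<omega>) = (LBINT x. k x \<omega>)"
      by (simp add: fourier_cis)
  qed simp
  also have "\<dots> = (LBINT x. LBINT \<omega>. k x \<omega>)"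
    by (rule lborel_pair.Fubini_integral[OF int])
  also have "\<dots> = (LBINT x. sqrt (pi / a) *\<^sub>R (exp (- ((x - y)\<^sup>2 / (4 * a))) *\<^sub>R f x))"
  proof (rule Bochner_Integration.integral_cong)
    fix x
    have "(LBINT \<omega>. k x \<omega>) = (LBINT \<omega>. f x * (exp (- (a * \<omega>\<^sup>2)) *\<^sub>R cis (\<omega> * (y - x))))"
      by (simp add: k_def)
    also have "\<dots> = f x * of_real (sqrt (pi / a) * exp (- ((y - x)\<^sup>2 / (4 * a))))"
      by (subst integral_mult_right_zero) (simp add: fourier_gaussian[OF a])
    finally show "(LBINT \<omega>. k x \<omega>) = sqrt (pi / a) *\<^sub>R (exp (- ((x - y)\<^sup>2 / (4 * a))) *\<^sub>R f x)"
      by (simp add: scaleR_conv_of_real power2_commute)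
  qed simp
  also have "\<dots> = sqrt (pi / a) *\<^sub>R (LBINT x. exp (- ((x - y)\<^sup>2 / (4 * a))) *\<^sub>R f x)"
    by (rule integral_scaleR_right)
  finally show ?thesis .
qed

text \<open>
  Gaussian integrability rather than square integrability of \<open>f\<close> and \<open>g\<close> is required, because it
  is preserved by sums without any further argument.
\<close>

definition gauss_pair :: "(real \<Rightarrow> complex) \<Rightarrow> (real \<Rightarrow> complex) \<Rightarrow> bool" where
  "gauss_pair f g \<longleftrightarrow> continuous_on UNIV f
     \<and> (\<forall>a>0. \<forall>y. integrable lborel (\<lambda>x. exp (- (a * (x - y)\<^sup>2)) *\<^sub>R f x))
     \<and> (\<forall>a>0. integrable lborel (\<lambda>\<omega>. exp (- (a * \<omega>\<^sup>2)) *\<^sub>R g \<omega>))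
     \<and> (\<forall>a>0. \<forall>y. (LBINT \<omega>. exp (- (a * \<omega>\<^sup>2)) *\<^sub>R (cis (\<omega> * y) * g \<omega>)) =
           sqrt (pi / a) *\<^sub>R (LBINT x. exp (- ((x - y)\<^sup>2 / (4 * a))) *\<^sub>R f x))"

section \<open>Stability of Gaussian pairs under sums, multiples and shifts\<close>

lemma integrable_modulation:
  assumes "integrable lborel (\<lambda>\<omega>. w \<omega> *\<^sub>R (g \<omega> :: complex))"
  shows "integrable lborel (\<lambda>\<omega>. w \<omega> *\<^sub>R (cis (\<omega> * y) * g \<omega>))"
proof (rule Bochner_Integration.integrable_bound[OF assms])
  have "(\<lambda>\<omega>. cis (\<omega> * y) * (w \<omega> *\<^sub>R g \<omega>)) \<in> borel_measurable lborel"
    using assms by measurable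
  then show "(\<lambda>\<omega>. w \<omega> *\<^sub>R (cis (\<omega> * y) * g \<omega>)) \<in> borel_measurable lborel"
    by (simp add: mult_scaleR_right)
qed (simp add: norm_mult)

lemma gauss_pair_add:
  assumes "gauss_pair f g" "gauss_pair f' g'"
  shows "gauss_pair (\<lambda>x. f x + f' x) (\<lambda>\<omega>. g \<omega> + g' \<omega>)"
  unfolding gauss_pair_def
proof (intro conjI allI impI)
  show "continuous_on UNIV (\<lambda>x. f x + f' x)"
    using assms by (auto simp: gauss_pair_def intro!: continuous_intros)
  fix a :: real assume a: "a > 0"
  have ig: "integrable lborel (\<lambda>\<omega>. exp (- (a * \<omega>\<^sup>2)) *\<^sub>R g \<omega>)"
           "integrable lborel (\<lambda>\<omega>. exp (- (a * \<omega>\<^sup>2)) *\<^sub>R g' \<omega>)"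
    using assms a by (auto simp: gauss_pair_def)
  then show "integrable lborel (\<lambda>\<omega>. exp (- (a * \<omega>\<^sup>2)) *\<^sub>R (g \<omega> + g' \<omega>))"
    by (simp add: scaleR_add_right)
  fix y :: real
  have "integrable lborel (\<lambda>x. exp (- (b * (x - y)\<^sup>2)) *\<^sub>R f x)"
       "integrable lborel (\<lambda>x. exp (- (b * (x - y)\<^sup>2)) *\<^sub>R f' x)" if "b > 0" for b
    using assms that by (auto simp: gauss_pair_def)
  note i = this
  from i[OF a] show "integrable lborel (\<lambda>x. exp (- (a * (x - y)\<^sup>2)) *\<^sub>R (f x + f' x))"
    by (simp add: scaleR_add_right)
  have i': "integrable lborel (\<lambda>x. exp (- ((x - y)\<^sup>2 / (4 * a))) *\<^sub>R f x)"
       "integrable lborel (\<lambda>x. exp (- ((x - y)\<^sup>2 / (4 * a))) *\<^sub>R f' x)"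
    using i[of "1 / (4 * a)"] a by simp_all
  have e: "(LBINT \<omega>. exp (- (a * \<omega>\<^sup>2)) *\<^sub>R (cis (\<omega> * y) * g \<omega>)) =
           sqrt (pi / a) *\<^sub>R (LBINT x. exp (- ((x - y)\<^sup>2 / (4 * a))) *\<^sub>R f x)"
          "(LBINT \<omega>. exp (- (a * \<omega>\<^sup>2)) *\<^sub>R (cis (\<omega> * y) * g' \<omega>)) =
           sqrt (pi / a) *\<^sub>R (LBINT x. exp (- ((x - y)\<^sup>2 / (4 * a))) *\<^sub>R f' x)"
    using assms a by (auto simp: gauss_pair_def)
  show "(LBINT \<omega>. exp (- (a * \<omega>\<^sup>2)) *\<^sub>R (cis (\<omega> * y) * (g \<omega> + g' \<omega>))) =
         sqrt (pi / a) *\<^sub>R (LBINT x. exp (- ((x - y)\<^sup>2 / (4 * a))) *\<^sub>R (f x + f' x))"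
    unfolding scaleR_add_right distrib_left
    by (subst (1 2) Bochner_Integration.integral_add)
       (simp_all add: e i' integrable_modulation ig scaleR_add_right)
qed

lemma gauss_pair_cmult:
  assumes "gauss_pair f g"
  shows "gauss_pair (\<lambda>x. c * f x) (\<lambda>\<omega>. c * g \<omega>)"
  unfolding gauss_pair_def
proof (intro conjI allI impI)
  show "continuous_on UNIV (\<lambda>x. c * f x)"
    using assms by (auto simp: gauss_pair_def intro!: continuous_intros)
  fix a :: real assume a: "a > 0"
  have "integrable lborel (\<lambda>\<omega>. c * (exp (- (a * \<omega>\<^sup>2)) *\<^sub>R g \<omega>))"
    using assms a by (intro integrable_mult_right) (auto simp: gauss_pair_def)
  then show "integrable lborel (\<lambda>\<omega>. exp (- (a * \<omega>\<^sup>2)) *\<^sub>R (c * g \<omega>))"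
    by (simp only: mult_scaleR_right)
  fix y :: real
  have "integrable lborel (\<lambda>x. c * (exp (- (a * (x - y)\<^sup>2)) *\<^sub>R f x))"
    using assms a by (intro integrable_mult_right) (auto simp: gauss_pair_def)
  then show "integrable lborel (\<lambda>x. exp (- (a * (x - y)\<^sup>2)) *\<^sub>R (c * f x))"
    by (simp only: mult_scaleR_right)
  have "(LBINT \<omega>. exp (- (a * \<omega>\<^sup>2)) *\<^sub>R (cis (\<omega> * y) * g \<omega>)) =
           sqrt (pi / a) *\<^sub>R (LBINT x. exp (- ((x - y)\<^sup>2 / (4 * a))) *\<^sub>R f x)"
    using assms a by (auto simp: gauss_pair_def)
  then show "(LBINT \<omega>. exp (- (a * \<omega>\<^sup>2)) *\<^sub>R (cis (\<omega> * y) * (c * g \<omega>))) =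
           sqrt (pi / a) *\<^sub>R (LBINT x. exp (- ((x - y)\<^sup>2 / (4 * a))) *\<^sub>R (c * f x))"
    by (simp only: mult.left_commute[of _ c] mult_scaleR_right[symmetric] integral_mult_right_zero)
qed

text \<open>The phase \<open>cis (h * \<omega>)\<close> combines with
  \<open>cis (\<omega> * y)\<close> and moves the base point to \<open>y + h\<close>; translating
  the space integral by \<open>h\<close> does the same. This is why the pairing is demanded at every
  \<open>y\<close>.\<close>

lemma gauss_pair_shift:
  assumes "gauss_pair f g"
  shows "gauss_pair (\<lambda>x. f (x + h)) (\<lambda>\<omega>. cis (h * \<omega>) * g \<omega>)"
  unfolding gauss_pair_def
proof (intro conjI allI impI)
  show "continuous_on UNIV (\<lambda>x. f (x + h))"
    using assms by (intro continuous_on_compose2[of UNIV f UNIV "\<lambda>x. x + h"] continuous_intros)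
      (auto simp: gauss_pair_def)
  fix a :: real assume a: "a > 0"
  have ig: "integrable lborel (\<lambda>\<omega>. exp (- (a * \<omega>\<^sup>2)) *\<^sub>R g \<omega>)"
    using assms a by (auto simp: gauss_pair_def)
  from integrable_modulation[OF this, of h]
  show "integrable lborel (\<lambda>\<omega>. exp (- (a * \<omega>\<^sup>2)) *\<^sub>R (cis (h * \<omega>) * g \<omega>))"
    by (simp add: mult.commute)
  fix y :: real
  have "integrable lborel (\<lambda>x. exp (- (a * (x - (y + h))\<^sup>2)) *\<^sub>R f x)"
    using assms a by (auto simp: gauss_pair_def)
  from lborel_integrable_real_affine[OF this, of 1 h]
  show "integrable lborel (\<lambda>x. exp (- (a * (x - y)\<^sup>2)) *\<^sub>R f (x + h))"
    by (simp add: algebra_simps)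
  have "cis (\<omega> * y) * (cis (h * \<omega>) * g \<omega>) = cis (\<omega> * (y + h)) * g \<omega>" for \<omega>
    unfolding mult.assoc[symmetric] cis_mult by (simp only: distrib_left mult.commute)
  then have "(LBINT \<omega>. exp (- (a * \<omega>\<^sup>2)) *\<^sub>R (cis (\<omega> * y) * (cis (h * \<omega>) * g \<omega>))) =
        (LBINT \<omega>. exp (- (a * \<omega>\<^sup>2)) *\<^sub>R (cis (\<omega> * (y + h)) * g \<omega>))"
    by (simp only:)
  also have "\<dots> = sqrt (pi / a) *\<^sub>R (LBINT x. exp (- ((x - (y + h))\<^sup>2 / (4 * a))) *\<^sub>R f x)"
    using assms a by (auto simp: gauss_pair_def)
  also have "(LBINT x. exp (- ((x - (y + h))\<^sup>2 / (4 * a))) *\<^sub>R f x) =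
             (LBINT x. exp (- ((x - y)\<^sup>2 / (4 * a))) *\<^sub>R f (x + h))"
    by (subst lborel_integral_real_affine[of 1 _ h]) (simp_all add: algebra_simps)
  finally show "(LBINT \<omega>. exp (- (a * \<omega>\<^sup>2)) *\<^sub>R (cis (\<omega> * y) * (cis (h * \<omega>) * g \<omega>))) =
     sqrt (pi / a) *\<^sub>R (LBINT x. exp (- ((x - y)\<^sup>2 / (4 * a))) *\<^sub>R f (x + h))" .
qed

section \<open>Gaussian pairs from integrable and from square integrable functions\<close>

lemma gauss_pair_fourier:
  assumes f: "integrable lborel f" and c: "continuous_on UNIV f"
  shows "gauss_pair f (fourier f)"
  unfolding gauss_pair_def
proof (intro conjI allI impI c fourier_gaussian_duality f)
  have [measurable]: "f \<in> borel_measurable borel" using f by auto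
  fix a :: real assume a: "a > 0"
  show "integrable lborel (\<lambda>x. exp (- (a * (x - y)\<^sup>2)) *\<^sub>R f x)" for y
  proof (rule Bochner_Integration.integrable_bound[OF f])
    show "AE x in lborel. norm (exp (- (a * (x - y)\<^sup>2)) *\<^sub>R f x) \<le> norm (f x)"
      using a by (auto intro!: AE_I2 mult_left_le_one_le)
  qed simp
  have "integrable lborel (\<lambda>\<omega>. exp (- (a * \<omega>\<^sup>2)) * (LBINT x. norm (f x)))"
    using integrable_gaussian[OF a, of 0] by simp
  then show "integrable lborel (\<lambda>\<omega>. exp (- (a * \<omega>\<^sup>2)) *\<^sub>R fourier f \<omega>)"
    by (rule Bochner_Integration.integrable_bound)
       (auto intro!: AE_I2 mult_left_mono order_trans[OF norm_fourier_le])
qed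

text \<open>The duality holds for the truncations \<open>u R\<close>, which are integrable, and
  passes to the limit: on the frequency side by Cauchy-Schwarz against the square integrable
  Gaussian, on the space side by dominated convergence.\<close>

lemma gauss_pair_L2_fourier:
  assumes fg: "continuous_L2_with_fourier f g" and g [measurable]: "g \<in> borel_measurable borel"
  shows "gauss_pair f g"
proof -
  have cont: "continuous_on UNIV f" and [measurable]: "f \<in> borel_measurable borel"
    and L2: "integrable lborel (\<lambda>x. (norm (f x))\<^sup>2)" and has: "has_L2_fourier f g"
    using fg by (auto simp: continuous_L2_with_fourier_def square_integrable_def)
  \<comment> \<open>This bounds \<open>norm (f x)\<close> through its integrable square: on a
    bounded interval up to the indicator, under a Gaussian weight up to the weight.\<close>
  have sq: "t \<le> 1 + t\<^sup>2" for t :: real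
    using zero_le_power2[of "t - 1 / 2"] by (simp add: power2_eq_square algebra_simps)
  define u where "u = (\<lambda>R x. indicator {- R..R} x * f x)"
  have iu: "integrable lborel (u R)" for R
  proof (rule Bochner_Integration.integrable_bound)
    show "integrable lborel (\<lambda>x. indicator {- R..R} x + (norm (f x))\<^sup>2 :: real)"
      using L2 by (intro Bochner_Integration.integrable_add integrable_real_indicator)
        (auto simp: emeasure_lborel_Icc_eq)
    show "AE x in lborel. norm (u R x) \<le> norm (indicator {- R..R} x + (norm (f x))\<^sup>2 :: real)"
      using sq by (auto intro!: AE_I2 simp: u_def indicator_def norm_mult)
  qed (simp add: u_def)
  have [measurable]: "u R \<in> borel_measurable borel" for R unfolding u_def by measurable
  define D where "D = (\<lambda>R \<omega>. g \<omega> - fourier (u R) \<omega>)"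
  have [measurable]: "D R \<in> borel_measurable borel" for R unfolding D_def by measurable
  define E where "E = (\<lambda>R. \<integral>\<^sup>+ \<omega>. ennreal ((norm (D R \<omega>))\<^sup>2) \<partial>lborel)"
  have E: "(E \<longlongrightarrow> 0) at_top"
    using has unfolding has_L2_fourier_def E_def D_def u_def .
  \<comment> \<open>\<open>E R\<close> is an extended real; 1 is an arbitrary finite threshold that
    makes it finite for large \<open>R\<close>.\<close>
  have fin: "eventually (\<lambda>R. E R < 1) at_top"
    using order_tendstoD(2)[OF E, of 1] by simp
  have intf: "integrable lborel (\<lambda>x. exp (- (a * (x - y)\<^sup>2)) *\<^sub>R f x)" if a: "a > 0" for a y
  proof (rule Bochner_Integration.integrable_bound)
    show "integrable lborel (\<lambda>x. exp (- (a * (x - y)\<^sup>2)) + (norm (f x))\<^sup>2)"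
      using L2 integrable_gaussian[OF a] by (intro Bochner_Integration.integrable_add) auto
    show "AE x in lborel. norm (exp (- (a * (x - y)\<^sup>2)) *\<^sub>R f x)
        \<le> norm (exp (- (a * (x - y)\<^sup>2)) + (norm (f x))\<^sup>2)"
    proof (intro AE_I2)
      fix x
      define e where "e = exp (- (a * (x - y)\<^sup>2))"
      have e: "0 \<le> e" "e \<le> 1" using a by (auto simp: e_def)
      have "e * norm (f x) \<le> e * (1 + (norm (f x))\<^sup>2)" using e sq by (intro mult_left_mono)
      also have "\<dots> \<le> e + (norm (f x))\<^sup>2"
        using e mult_left_le_one_le[of "(norm (f x))\<^sup>2" e] by (simp add: algebra_simps)
      finally show "norm (e *\<^sub>R f x) \<le> norm (e + (norm (f x))\<^sup>2)" using e by simp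
    qed
  qed simp
  have main: "integrable lborel (\<lambda>\<omega>. exp (- (a * \<omega>\<^sup>2)) *\<^sub>R g \<omega>) \<and>
     (LBINT \<omega>. exp (- (a * \<omega>\<^sup>2)) *\<^sub>R (cis (\<omega> * y) * g \<omega>)) =
           sqrt (pi / a) *\<^sub>R (LBINT x. exp (- ((x - y)\<^sup>2 / (4 * a))) *\<^sub>R f x)" if a: "a > 0" for a y
  proof -
    define w where "w = (\<lambda>\<omega>::real. exp (- (a * \<omega>\<^sup>2)))"
    have [measurable]: "w \<in> borel_measurable borel" unfolding w_def by measurable
    have w0: "w \<omega> \<ge> 0" for \<omega> by (simp add: w_def)
    define G where "G = (\<integral>\<^sup>+ \<omega>. (ennreal (w \<omega>))\<^sup>2 \<partial>lborel)"
    have w2: "(w \<omega>)\<^sup>2 = exp (- ((2 * a) * (\<omega> - 0)\<^sup>2))" for \<omega>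
      by (simp add: w_def power2_eq_square exp_add[symmetric])
    have "integrable lborel (\<lambda>\<omega>. (w \<omega>)\<^sup>2)"
      unfolding w2 by (rule integrable_gaussian) (use a in simp)
    then have "(\<integral>\<^sup>+ \<omega>. ennreal ((w \<omega>)\<^sup>2) \<partial>lborel) < top"
      by (subst (asm) integrable_iff_bounded) (simp add: w0)
    then have G: "G < top" by (simp add: G_def ennreal_power w0)
    \<comment> \<open>Cauchy-Schwarz for nonnegative integrals presupposes no integrability, so it
      can yield the integrability of the weighted \<open>D R\<close> in the next step.\<close>
    have CS: "(\<integral>\<^sup>+ \<omega>. ennreal (norm (w \<omega> *\<^sub>R D R \<omega>)) \<partial>lborel)\<^sup>2 \<le> G * E R" for R
      using Cauchy_Schwarz_nn_integral[of "\<lambda>\<omega>. ennreal (w \<omega>)" lborel "\<lambda>\<omega>. ennreal (norm (D R \<omega>))"]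
      by (simp add: G_def E_def ennreal_power ennreal_mult w0)
    have iD: "integrable lborel (\<lambda>\<omega>. w \<omega> *\<^sub>R D R \<omega>)" if "E R < 1" for R
    proof (rule integrableI_bounded)
      have "G * E R < top" using that G by (simp add: ennreal_mult_less_top order.strict_trans)
      with CS[of R] have "(\<integral>\<^sup>+ \<omega>. ennreal (norm (w \<omega> *\<^sub>R D R \<omega>)) \<partial>lborel)\<^sup>2 < top"
        by (rule le_less_trans)
      then show "(\<integral>\<^sup>+ \<omega>. ennreal (norm (w \<omega> *\<^sub>R D R \<omega>)) \<partial>lborel) < \<infinity>"
        by (simp add: power_less_top_ennreal)
    qed simp
    have iF: "integrable lborel (\<lambda>\<omega>. w \<omega> *\<^sub>R fourier (u R) \<omega>)" for R
    proof (rule Bochner_Integration.integrable_bound)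
      show "integrable lborel (\<lambda>\<omega>. w \<omega> * (LBINT x. norm (u R x)))"
        using integrable_gaussian[OF a, of 0] by (simp add: w_def)
    qed (auto intro!: AE_I2 mult_left_mono order_trans[OF norm_fourier_le] simp: w0)
    \<comment> \<open>A single truncation with finite error suffices: \<open>g\<close> is the sum of
      \<open>D R0\<close> and \<open>fourier (u R0)\<close>, both integrable against the
      weight.\<close>
    obtain R0 where R0: "E R0 < 1" using fin by (auto simp: eventually_at_top_linorder)
    from Bochner_Integration.integrable_add[OF iD[OF R0] iF[of R0]]
    have ig: "integrable lborel (\<lambda>\<omega>. w \<omega> *\<^sub>R g \<omega>)"
      by (simp add: D_def scaleR_add_right[symmetric])
    define I where "I = (LBINT \<omega>. w \<omega> *\<^sub>R (cis (\<omega> * y) * g \<omega>))"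
    define J where "J = (\<lambda>R. sqrt (pi / a) *\<^sub>R (LBINT x. exp (- ((x - y)\<^sup>2 / (4 * a))) *\<^sub>R u R x))"
    have J: "J R = (LBINT \<omega>. w \<omega> *\<^sub>R (cis (\<omega> * y) * fourier (u R) \<omega>))" for R
      unfolding J_def w_def by (rule fourier_gaussian_duality[OF iu a, symmetric])
    \<comment> \<open>Up to sign, \<open>J R - I\<close> is the weighted integral of
      \<open>D R\<close> times a phase of modulus one, so \<open>CS\<close> controls its
      square.\<close>
    have bd: "ennreal ((norm (J R - I))\<^sup>2) \<le> G * E R" if R: "E R < 1" for R
    proof -
      have "I - J R = (LBINT \<omega>. w \<omega> *\<^sub>R (cis (\<omega> * y) * D R \<omega>))"
        unfolding J I_def
          Bochner_Integration.integral_diff[OF integrable_modulation[OF ig] integrable_modulation[OF iF], symmetric]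
        by (simp add: D_def scaleR_diff_right right_diff_distrib)
      then have "ennreal (norm (J R - I)) \<le> (\<integral>\<^sup>+ \<omega>. ennreal (norm (w \<omega> *\<^sub>R (cis (\<omega> * y) * D R \<omega>))) \<partial>lborel)"
        using integral_norm_bound_ennreal[OF integrable_modulation[OF iD[OF R], of y]]
        by (simp add: norm_minus_commute)
      also have "\<dots> = (\<integral>\<^sup>+ \<omega>. ennreal (norm (w \<omega> *\<^sub>R D R \<omega>)) \<partial>lborel)"
        by (simp add: norm_mult)
      finally have "(ennreal (norm (J R - I)))\<^sup>2 \<le> (\<integral>\<^sup>+ \<omega>. ennreal (norm (w \<omega> *\<^sub>R D R \<omega>)) \<partial>lborel)\<^sup>2"
        by (rule power_mono) simp
      with CS[of R] show ?thesis by (simp add: ennreal_power)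
    qed
    have GE: "((\<lambda>R. G * E R) \<longlongrightarrow> 0) at_top"
      using ennreal_tendsto_cmult[OF G E] by simp
    have "((\<lambda>R. ennreal ((norm (J R - I))\<^sup>2)) \<longlongrightarrow> 0) at_top"
      by (rule tendsto_sandwich[OF _ _ tendsto_const GE])
         (use fin in \<open>auto elim!: eventually_mono intro!: bd\<close>)
    then have "((\<lambda>R. (norm (J R - I))\<^sup>2) \<longlongrightarrow> 0) at_top"
      using tendsto_ennrealD[of "\<lambda>R. (norm (J R - I))\<^sup>2" 0 at_top] by simp
    then have "((\<lambda>R. norm (J R - I)) \<longlongrightarrow> 0) at_top"
      using tendsto_real_sqrt[of "\<lambda>R. (norm (J R - I))\<^sup>2" 0 at_top] by simp
    then have 1: "(J \<longlongrightarrow> I) at_top"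
      by (simp add: tendsto_norm_zero_iff LIM_zero_iff)
    have if': "integrable lborel (\<lambda>x. exp (- ((x - y)\<^sup>2 / (4 * a))) *\<^sub>R f x)"
      using intf[of "1 / (4 * a)" y] a by simp
    \<comment> \<open>\<open>u R x\<close> equals \<open>f x\<close> once \<open>R\<close> reaches
      the absolute value of \<open>x\<close>, and never exceeds it in norm, so the weighted
      \<open>f\<close> is the dominating function.\<close>
    have 2: "(J \<longlongrightarrow> sqrt (pi / a) *\<^sub>R (LBINT x. exp (- ((x - y)\<^sup>2 / (4 * a))) *\<^sub>R f x)) at_top"
      unfolding J_def
    proof (intro tendsto_intros integral_dominated_convergence_at_top)
      show "integrable lborel (\<lambda>x. norm (exp (- ((x - y)\<^sup>2 / (4 * a))) *\<^sub>R f x))"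
        using if' by (rule integrable_norm)
      show "AE x in lborel. ((\<lambda>R. exp (- ((x - y)\<^sup>2 / (4 * a))) *\<^sub>R u R x) \<longlongrightarrow>
              exp (- ((x - y)\<^sup>2 / (4 * a))) *\<^sub>R f x) at_top"
      proof (intro AE_I2 tendsto_eventually)
        fix x :: real
        show "\<forall>\<^sub>F R in at_top. exp (- ((x - y)\<^sup>2 / (4 * a))) *\<^sub>R u R x =
              exp (- ((x - y)\<^sup>2 / (4 * a))) *\<^sub>R f x"
          using eventually_ge_at_top[of "\<bar>x\<bar>"] by eventually_elim (auto simp: u_def indicator_def)
      qed
      show "\<forall>\<^sub>F R in at_top. AE x in lborel. norm (exp (- ((x - y)\<^sup>2 / (4 * a))) *\<^sub>R u R x)
          \<le> norm (exp (- ((x - y)\<^sup>2 / (4 * a))) *\<^sub>R f x)"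
        by (intro always_eventually allI AE_I2) (auto simp: u_def indicator_def)
    qed simp_all
    from tendsto_unique[OF _ 1 2] ig show ?thesis
      by (simp add: I_def w_def)
  qed
  show ?thesis
    unfolding gauss_pair_def using cont intf main by auto
qed

section \<open>Uniqueness from Gaussian averages\<close>

lemma gaussian_averages_zero_imp_zero:
  assumes cont: "continuous_on UNIV h"
    and int: "\<And>a. a > 0 \<Longrightarrow> integrable lborel (\<lambda>x. exp (- (a * (x - y)\<^sup>2)) *\<^sub>R h x)"
    and zero: "\<And>a. a > 0 \<Longrightarrow> (LBINT x. exp (- (a * (x - y)\<^sup>2)) *\<^sub>R h x) = 0"
  shows "h y = (0::complex)"
proof -
  have [measurable]: "h \<in> borel_measurable borel"
    using cont by (rule borel_measurable_continuous_onI)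
  \<comment> \<open>Translation moves the evaluation point to 0. The weights
    \<open>(k + 1) * exp (- (k + 1)^2 * x^2)\<close> all have integral \<open>sqrt pi\<close> and
    concentrate at 0, so the averages of \<open>H\<close>, which all vanish, must tend to
    \<open>sqrt pi\<close> times \<open>H 0 = h y\<close>.\<close>
  define H where "H = (\<lambda>x. h (y + x))"
  have [measurable]: "H \<in> borel_measurable borel" unfolding H_def by measurable
  have contH: "continuous_on UNIV H" unfolding H_def
    by (intro continuous_on_compose2[OF cont] continuous_intros) auto
  have intH: "integrable lborel (\<lambda>x. exp (- (a * x\<^sup>2)) *\<^sub>R H x)" if "a > 0" for a
    using lborel_integrable_real_affine[OF int[OF that], of 1 y] by (simp add: H_def)
  have zeroH: "(LBINT x. exp (- (a * x\<^sup>2)) *\<^sub>R H x) = 0" if "a > 0" for a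
    using zero[OF that] lborel_integral_real_affine[of 1 "\<lambda>x. exp (- (a * (x - y)\<^sup>2)) *\<^sub>R h x" y]
    by (simp add: H_def)
  \<comment> \<open>Near 0 rescaling turns the average into a multiple of \<open>h y\<close>; \<open>h\<close> may be unbounded, so the
    part far from 0 is dominated by a fixed Gaussian average of \<open>h\<close> instead.\<close>
  define near where "near = (\<lambda>k::nat. LBINT x. indicator {-1..1} x *\<^sub>R (real (Suc k) * exp (- ((real (Suc k))\<^sup>2 * x\<^sup>2))) *\<^sub>R H x)"
  define far where "far = (\<lambda>k::nat. LBINT x. indicator (- {-1..1}) x *\<^sub>R (real (Suc k) * exp (- ((real (Suc k))\<^sup>2 * x\<^sup>2))) *\<^sub>R H x)"
  have i: "integrable lborel (\<lambda>x. (real (Suc k) * exp (- ((real (Suc k))\<^sup>2 * x\<^sup>2))) *\<^sub>R H x)" for k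
    using integrable_scaleR_right[OF intH[of "(real (Suc k))\<^sup>2"], of "real (Suc k)"]
    by (simp only: scaleR_scaleR) simp
  have sum0: "near k + far k = 0" for k
  proof -
    have "near k + far k = (LBINT x. indicator {-1..1} x *\<^sub>R (real (Suc k) * exp (- ((real (Suc k))\<^sup>2 * x\<^sup>2))) *\<^sub>R H x
        + indicator (- {-1..1}) x *\<^sub>R (real (Suc k) * exp (- ((real (Suc k))\<^sup>2 * x\<^sup>2))) *\<^sub>R H x)"
      unfolding near_def far_def
      by (rule Bochner_Integration.integral_add[symmetric]; rule integrable_mult_indicator[OF _ i]) auto
    also have "\<dots> = (LBINT x. (real (Suc k) * exp (- ((real (Suc k))\<^sup>2 * x\<^sup>2))) *\<^sub>R H x)"
      by (rule Bochner_Integration.integral_cong) (auto simp: indicator_def)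
    also have "\<dots> = real (Suc k) *\<^sub>R (LBINT x. exp (- ((real (Suc k))\<^sup>2 * x\<^sup>2)) *\<^sub>R H x)"
      by (simp only: scaleR_scaleR[symmetric] integral_scaleR_right)
    also have "\<dots> = 0" by (simp add: zeroH del: of_nat_Suc)
    finally show ?thesis .
  qed
  have far: "far \<longlonglongrightarrow> (LBINT x::real. 0)"
    unfolding far_def
  proof (rule integral_dominated_convergence)
    show "integrable lborel (\<lambda>x. norm (exp (- (1 / 2 * x\<^sup>2)) *\<^sub>R H x))"
      by (intro integrable_norm intH) simp
    fix k :: nat
    define K where "K = real (Suc k)"
    have K: "K \<ge> 1" by (simp add: K_def)
    show "AE x in lborel. norm (indicator (- {-1..1}) x *\<^sub>R (real (Suc k) * exp (- ((real (Suc k))\<^sup>2 * x\<^sup>2))) *\<^sub>R H x)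
        \<le> norm (exp (- (1 / 2 * x\<^sup>2)) *\<^sub>R H x)"
      unfolding K_def[symmetric]
    proof (intro AE_I2)
      fix x :: real
      \<comment> \<open>The exponent \<open>1 / 2\<close> leaves room for the factor
        \<open>K\<close>: since \<open>K \<ge> 1\<close> and \<open>x^2 \<ge> 1\<close>, one has
        \<open>K \<le> 1 + (K^2 - 1/2) * x^2 \<le> exp ((K^2 - 1/2) * x^2)\<close>.\<close>
      have "K * exp (- (K\<^sup>2 * x\<^sup>2)) \<le> exp (- (1 / 2 * x\<^sup>2))" if "\<not> (-1 \<le> x \<and> x \<le> 1)"
      proof -
        have x: "1 \<le> x\<^sup>2" using that abs_square_less_1[of x] by (auto simp: not_less[symmetric])
        have "K - 1 \<le> (K\<^sup>2 - 1 / 2) * 1"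
          using zero_le_power2[of "K - 1"] K by (simp add: power2_eq_square algebra_simps)
        also have "\<dots> \<le> (K\<^sup>2 - 1 / 2) * x\<^sup>2"
          using x one_le_power[OF K, of 2] by (intro mult_left_mono) auto
        finally have "K \<le> exp ((K\<^sup>2 - 1 / 2) * x\<^sup>2)"
          using exp_ge_add_one_self[of "(K\<^sup>2 - 1 / 2) * x\<^sup>2"] by linarith
        then have "K * exp (- (K\<^sup>2 * x\<^sup>2)) \<le> exp ((K\<^sup>2 - 1 / 2) * x\<^sup>2) * exp (- (K\<^sup>2 * x\<^sup>2))"
          by (rule mult_right_mono) simp
        also have "\<dots> = exp (- (1 / 2 * x\<^sup>2))"
          by (simp add: exp_add[symmetric] algebra_simps)
        finally show ?thesis .
      qed
      then show "norm (indicator (- {-1..1}) x *\<^sub>R (K * exp (- (K\<^sup>2 * x\<^sup>2))) *\<^sub>R H x) \<le> norm (exp (- (1 / 2 * x\<^sup>2)) *\<^sub>R H x)"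
        using K by (auto simp: indicator_def intro!: mult_right_mono)
    qed
  next
    show "AE x in lborel. (\<lambda>k. indicator (- {-1..1}) x *\<^sub>R (real (Suc k) * exp (- ((real (Suc k))\<^sup>2 * x\<^sup>2))) *\<^sub>R H x) \<longlonglongrightarrow> 0"
    proof (intro AE_I2)
      fix x :: real
      show "(\<lambda>k. indicator (- {-1..1}) x *\<^sub>R (real (Suc k) * exp (- ((real (Suc k))\<^sup>2 * x\<^sup>2))) *\<^sub>R H x) \<longlonglongrightarrow> 0"
      proof (cases "x = 0")
        case False
        then have "x\<^sup>2 > 0" by simp
        then have "(\<lambda>k. real (Suc k) * exp (- ((real (Suc k))\<^sup>2 * x\<^sup>2))) \<longlonglongrightarrow> 0"
          by real_asymp
        from tendsto_scaleR[OF tendsto_const[of "indicator (- {-1..1}) x"] tendsto_scaleR[OF this tendsto_const[of "H x"]]]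
        show ?thesis by simp
      qed simp
    qed
  qed simp_all
  have "bounded (H ` {-1..1})"
    by (intro compact_imp_bounded compact_continuous_image continuous_on_subset[OF contH]) auto
  then obtain M where "\<forall>x\<in>{-1..1}. norm (H x) \<le> M"
    by (auto simp: bounded_iff)
  then have M: "norm (H x) \<le> M" if "x \<in> {-1..1}" for x using that by blast
  \<comment> \<open>\<open>v k\<close> is the near integrand after substituting
    \<open>x = z / (k + 1)\<close>, the factor \<open>k + 1\<close> being absorbed by the Jacobian.
    It is dominated by \<open>M * exp (- (z^2))\<close>, because the indicator confines the argument
    of \<open>H\<close> to \<open>{-1..1}\<close>.\<close>
  define v where "v = (\<lambda>k z. indicator {-1..1} (z / real (Suc k)) *\<^sub>R exp (- (z\<^sup>2)) *\<^sub>R H (z / real (Suc k)))"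
  have near_eq: "near k = (LBINT z. v k z)" for k
  proof -
    have "(LBINT z. v k z) = real (Suc k) *\<^sub>R (LBINT x. v k (real (Suc k) * x))"
      using lborel_integral_real_affine[of "real (Suc k)" "v k" 0] by (simp del: of_nat_Suc)
    also have "\<dots> = (LBINT x. real (Suc k) *\<^sub>R v k (real (Suc k) * x))"
      by (rule integral_scaleR_right[symmetric])
    also have "\<dots> = near k"
      unfolding near_def v_def
      by (rule Bochner_Integration.integral_cong) (simp_all add: power_mult_distrib del: of_nat_Suc)
    finally show ?thesis by simp
  qed
  have "(\<lambda>k. LBINT z. v k z) \<longlonglongrightarrow> (LBINT z. exp (- (z\<^sup>2)) *\<^sub>R h y)"
  proof (rule integral_dominated_convergence)
    show "integrable lborel (\<lambda>z. exp (- (1 * (z - 0)\<^sup>2)) * M)"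
      by (intro integrable_mult_left integrable_gaussian) simp
    show "(\<lambda>z. exp (- (z\<^sup>2)) *\<^sub>R h y) \<in> borel_measurable lborel" by simp
    fix k
    show "v k \<in> borel_measurable lborel" unfolding v_def by measurable
    show "AE z in lborel. norm (v k z) \<le> exp (- (1 * (z - 0)\<^sup>2)) * M"
    proof (intro AE_I2)
      fix z
      have "0 \<le> M" using M[of 0] norm_ge_zero[of "H 0"] by (simp del: norm_ge_zero)
      then show "norm (v k z) \<le> exp (- (1 * (z - 0)\<^sup>2)) * M"
        using M[of "z / real (Suc k)"] by (auto simp: v_def indicator_def simp del: of_nat_Suc)
    qed
  next
    show "AE z in lborel. (\<lambda>k. v k z) \<longlonglongrightarrow> exp (- (z\<^sup>2)) *\<^sub>R h y"
    proof (intro AE_I2)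
      fix z :: real
      have z0: "(\<lambda>k. z / real (Suc k)) \<longlonglongrightarrow> 0" by real_asymp
      have "isCont H 0" using contH by (simp add: continuous_on_eq_continuous_at)
      from isCont_tendsto_compose[OF this z0] have "(\<lambda>k. H (z / real (Suc k))) \<longlonglongrightarrow> h y"
        by (simp add: H_def)
      then have *: "(\<lambda>k. exp (- (z\<^sup>2)) *\<^sub>R H (z / real (Suc k))) \<longlonglongrightarrow> exp (- (z\<^sup>2)) *\<^sub>R h y"
        by (intro tendsto_intros)
      have "eventually (\<lambda>k. z / real (Suc k) < 1 \<and> z / real (Suc k) > -1) sequentially"
        using order_tendstoD(2)[OF z0, of 1] order_tendstoD(1)[OF z0, of "-1"]
        by (auto intro: eventually_conj)
      then have "eventually (\<lambda>k. exp (- (z\<^sup>2)) *\<^sub>R H (z / real (Suc k)) = v k z) sequentially"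
        by eventually_elim (simp add: v_def indicator_def)
      from Lim_transform_eventually[OF * this] show "(\<lambda>k. v k z) \<longlonglongrightarrow> exp (- (z\<^sup>2)) *\<^sub>R h y" .
    qed
  qed
  also have "(LBINT z. exp (- (z\<^sup>2)) *\<^sub>R h y) = sqrt pi *\<^sub>R h y"
    using integral_gaussian[of 1] integrable_gaussian[of 1 0] by simp
  finally have "near \<longlonglongrightarrow> sqrt pi *\<^sub>R h y" by (simp add: near_eq[abs_def])
  from tendsto_add[OF this far] have "(\<lambda>k. near k + far k) \<longlonglongrightarrow> sqrt pi *\<^sub>R h y" by simp
  then have "sqrt pi *\<^sub>R h y = 0" by (simp add: sum0 LIMSEQ_const_iff)
  then show ?thesis by simp
qed

text \<open>By linearity the difference of the two functions is paired with 0, so all its Gaussian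
  averages vanish.\<close>

lemma gauss_pair_unique:
  assumes "gauss_pair f g" "gauss_pair f' g"
  shows "f = f'"
proof
  fix y
  define h where "h = (\<lambda>x. f x + (-1) * f' x)"
  from gauss_pair_add[OF assms(1) gauss_pair_cmult[OF assms(2), of "-1"]]
  have gp: "gauss_pair h (\<lambda>\<omega>. 0)" by (simp add: h_def)
  have "h y = 0"
  proof (rule gaussian_averages_zero_imp_zero)
    show "continuous_on UNIV h" using gp by (auto simp: gauss_pair_def)
    fix a :: real assume a: "a > 0"
    show "integrable lborel (\<lambda>x. exp (- (a * (x - y)\<^sup>2)) *\<^sub>R h x)"
      using gp a by (auto simp: gauss_pair_def)
    \<comment> \<open>A frequency weight with parameter \<open>b\<close> appears in space with
      parameter \<open>1 / (4 * b)\<close>; this \<open>b\<close> makes the latter equal to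
      \<open>a\<close>.\<close>
    define b where "b = 1 / (4 * a)"
    have b: "b > 0" "\<And>x. (x - y)\<^sup>2 / (4 * b) = a * (x - y)\<^sup>2" using a by (auto simp: b_def)
    have "0 = sqrt (pi / b) *\<^sub>R (LBINT x. exp (- ((x - y)\<^sup>2 / (4 * b))) *\<^sub>R h x)"
      using gp b(1) by (auto simp: gauss_pair_def)
    then show "(LBINT x. exp (- (a * (x - y)\<^sup>2)) *\<^sub>R h x) = 0"
      using b by simp
  qed
  then show "f y = f' y" by (simp add: h_def)
qed

subsection \<open>B-splines\<close>

lemma bspline_Suc_eq: "bspline (Suc m) x = (LBINT t. indicator {0..1} t * bspline m (x - t))"
  by (simp add: set_lebesgue_integral_def)

lemma integrable_indicator_Icc: "integrable lborel (indicator {a..b} :: real \<Rightarrow> real)"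
  by (rule integrable_real_indicator) (auto simp: emeasure_lborel_Icc_eq)

lemma borel_measurable_bspline [measurable]: "bspline m \<in> borel_measurable borel"
proof (induction m)
  case 0
  show ?case by simp
next
  case (Suc m)
  note [measurable] = Suc
  show ?case unfolding bspline_Suc_eq[abs_def] by measurable
qed

lemma bspline_nonneg: "0 \<le> bspline m x"
  by (induction m arbitrary: x) (auto simp: bspline_Suc_eq simp del: bspline.simps(2) intro!: integral_nonneg_AE)

lemma bspline_le_1: "bspline m x \<le> 1"
proof (induction m arbitrary: x)
  case 0
  show ?case by (simp add: indicator_def)
next
  case (Suc m)
  have "bspline (Suc m) x \<le> (LBINT t. indicator {0..1::real} t :: real)"
    unfolding bspline_Suc_eq
  proof (rule integral_mono')
    show "indicator {0..1} t * bspline m (x - t) \<le> indicator {0..1::real} t" for t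
      using Suc by (simp add: indicator_def)
  qed (auto intro: integrable_indicator_Icc)
  then show ?case by simp
qed

lemma bspline_eq_0: "x \<notin> {0..real m + 1} \<Longrightarrow> bspline m x = 0"
proof (induction m arbitrary: x)
  case 0
  then show ?case by (auto simp: indicator_def)
next
  case (Suc m)
  have "indicator {0..1} t * bspline m (x - t) = 0" for t
    using Suc.prems Suc.IH[of "x - t"] by (auto simp: indicator_def)
  then show ?case unfolding bspline_Suc_eq by (simp only: integral_zero)
qed

lemma integrable_bspline: "integrable lborel (bspline m)"
proof (rule Bochner_Integration.integrable_bound)
  show "AE x in lborel. norm (bspline m x) \<le> norm (indicator {0..real m + 1} x :: real)"
    using bspline_le_1 bspline_nonneg bspline_eq_0 by (auto intro!: AE_I2 simp: indicator_def)
qed (simp_all add: integrable_indicator_Icc)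

section \<open>Continuity and derivatives of B-splines\<close>

lemma bspline_integrable_on: "bspline m integrable_on {a..b}"
  by (intro set_borel_integral_eq_integral(1) integrable_mult_indicator[folded set_integrable_def]
      integrable_bspline) simp

text \<open>The substitution \<open>s = x - t\<close> moves the variable into the limits; passing to
  the Henstock-Kurzweil integral gives access to the fundamental theorem of calculus.\<close>

lemma bspline_Suc_integral: "bspline (Suc m) x = integral {x - 1..x} (bspline m)"
proof -
  have "bspline (Suc m) x = (LBINT s. indicator {0..1} (x - s) * bspline m s)"
    unfolding bspline_Suc_eq by (subst lborel_integral_real_affine[of "-1" _ x]) simp_all
  also have "\<dots> = (LBINT s:{x - 1..x}. bspline m s)"
    unfolding set_lebesgue_integral_def
    by (rule Bochner_Integration.integral_cong) (auto simp: indicator_def)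
  also have "\<dots> = integral {x - 1..x} (bspline m)"
    by (intro set_borel_integral_eq_integral(2) integrable_mult_indicator[folded set_integrable_def]
      integrable_bspline) simp
  finally show ?thesis .
qed

text \<open>With a fixed base point \<open>a\<close>, both terms are values of one antiderivative,
  at \<open>x\<close> and at \<open>x - 1\<close>. Continuity and the derivative are read off from
  this form.\<close>

lemma bspline_Suc_antiderivative:
  assumes "a \<le> x - 1"
  shows "bspline (Suc m) x = integral {a..x} (bspline m) - integral {a..x - 1} (bspline m)"
  using Henstock_Kurzweil_Integration.integral_combine[of a "x - 1" x "bspline m"] assms
  by (simp add: bspline_Suc_integral bspline_integrable_on del: bspline.simps)

lemma isCont_bspline_Suc: "isCont (bspline (Suc m)) x"
proof -
  \<comment> \<open>The base point \<open>x - 3\<close> keeps \<open>u\<close> and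
    \<open>u - 1\<close> inside \<open>{x - 3..x + 3}\<close> for all \<open>u\<close> within
    distance 1 of \<open>x\<close>.\<close>
  define g where "g = (\<lambda>u. integral {x - 3..u} (bspline m))"
  have g: "continuous_on {x - 3..x + 3} g"
    unfolding g_def by (rule indefinite_integral_continuous_1) (rule bspline_integrable_on)
  have "continuous_on {x - 1<..<x + 1} (\<lambda>u. g u - g (u - 1))"
    by (intro continuous_intros continuous_on_subset[OF g] continuous_on_compose2[OF g]) auto
  moreover have "g u - g (u - 1) = bspline (Suc m) u" if "u \<in> {x - 1<..<x + 1}" for u
    using that by (subst bspline_Suc_antiderivative[of "x - 3"]) (auto simp: g_def)
  ultimately have "continuous_on {x - 1<..<x + 1} (bspline (Suc m))"
    by (rule continuous_on_eq)
  then show ?thesis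
    by (simp add: continuous_on_eq_continuous_at del: bspline.simps)
qed

lemma continuous_on_bspline: "n \<ge> 1 \<Longrightarrow> continuous_on A (bspline n)"
  by (cases n) (auto intro!: continuous_at_imp_continuous_on isCont_bspline_Suc simp del: bspline.simps)

text \<open>Fundamental theorem of calculus for the antiderivative form. It uses continuity of the
  integrand, which fails for the jumps of \<open>bspline 0\<close>; hence
  \<open>m \<ge> 1\<close>.\<close>

lemma has_real_derivative_bspline:
  assumes "m \<ge> 1"
  shows "(bspline (Suc m) has_real_derivative bspline m x - bspline m (x - 1)) (at x)"
proof -
  define g where "g = (\<lambda>u. integral {x - 3..u} (bspline m))"
  have g: "(g has_real_derivative bspline m u) (at u)" if "u \<in> {x - 3<..<x + 3}" for u
  proof -
    have "(g has_real_derivative bspline m u) (at u within {x - 3..x + 3})"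
      unfolding g_def using that assms
      by (intro integral_has_real_derivative continuous_on_bspline) auto
    then show ?thesis using that by (simp add: at_within_Icc_at)
  qed
  have "(g has_real_derivative bspline m (x - 1)) (at (x - 1))" "(g has_real_derivative bspline m x) (at x)"
    using g by auto
  then have "((\<lambda>u. g u - g (u - 1)) has_real_derivative bspline m x - bspline m (x - 1)) (at x)"
    using DERIV_shift[of g "bspline m (x - 1)" x "-1"] by (intro DERIV_diff) auto
  then show ?thesis
  proof (rule has_field_derivative_transform_within_open)
    show "open {x - 1<..<x + 1}" "x \<in> {x - 1<..<x + 1}" by auto
    show "g u - g (u - 1) = bspline (Suc m) u" if "u \<in> {x - 1<..<x + 1}" for u
      using that by (subst bspline_Suc_antiderivative[of "x - 3"]) (auto simp: g_def)
  qed
qed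

text \<open>Pascal's rule: after an index shift in the terms with \<open>g (Suc j)\<close>, the
  neighbouring coefficients of row \<open>k\<close> add up to those of row
  \<open>Suc k\<close>.\<close>

lemma alternating_binomial_sum_diff:
  fixes g :: "nat \<Rightarrow> real"
  shows "(\<Sum>j\<le>k. (-1) ^ j * of_nat (k choose j) * (g j - g (Suc j))) =
         (\<Sum>j\<le>Suc k. (-1) ^ j * of_nat (Suc k choose j) * g j)"
proof -
  have "(\<Sum>j\<le>k. (-1) ^ j * of_nat (k choose j) * g j) =
        (\<Sum>j\<le>Suc k. (-1) ^ j * of_nat (k choose j) * g j)"
    by simp
  also have "\<dots> = g 0 + (\<Sum>j\<le>k. (-1) ^ Suc j * of_nat (k choose Suc j) * g (Suc j))"
    by (subst sum.atMost_Suc_shift) simp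
  finally show ?thesis
    by (subst sum.atMost_Suc_shift)
       (simp add: algebra_simps sum.distrib sum_subtractf sum_negf)
qed

text \<open>Each differentiation lowers the order by one, takes a backward difference of step 1 and
  brings a factor 2 from the inner function. With \<open>Suc k < N\<close> the splines in the
  \<open>k\<close>-th derivative still have order at least 2, where the derivative formula
  applies.\<close>

lemma bspline_iterated_derivative:
  assumes "k < N"
  shows "(deriv ^^ k) (\<lambda>y. bspline N (2 * y + c)) =
    (\<lambda>y. 2 ^ k * (\<Sum>j\<le>k. (-1) ^ j * of_nat (k choose j) * bspline (N - k) (2 * y + c - real j)))"
    and "Suc k < N \<Longrightarrow> (deriv ^^ k) (\<lambda>y. bspline N (2 * y + c)) differentiable (at x)"
proof -
  define F where "F = (\<lambda>k y. 2 ^ k * (\<Sum>j\<le>k. (-1) ^ j * of_nat (k choose j) *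
    bspline (N - k) (2 * y + c - real j)))"
  have deriv_F: "(F k has_real_derivative F (Suc k) y) (at y)" if k: "Suc k < N" for k y
  proof -
    have N: "N - k = Suc (N - Suc k)" "N - Suc k \<ge> 1" using k by auto
    have *: "((\<lambda>y. bspline (N - k) (2 * y + c - real j)) has_real_derivative
        (bspline (N - Suc k) (2 * y + c - real j) - bspline (N - Suc k) (2 * y + c - real (Suc j))) * 2) (at y)" for j
      unfolding N(1)
      by (rule DERIV_chain2[where f = "bspline (Suc (N - Suc k))"])
         (use has_real_derivative_bspline[OF N(2), of "2 * y + c - real j"] in
            \<open>auto intro!: derivative_eq_intros simp: algebra_simps simp del: bspline.simps\<close>)
    have "(F k has_real_derivative 2 ^ k * (\<Sum>j\<le>k. (-1) ^ j * of_nat (k choose j) *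
        ((bspline (N - Suc k) (2 * y + c - real j) - bspline (N - Suc k) (2 * y + c - real (Suc j))) * 2))) (at y)"
      unfolding F_def by (intro DERIV_cmult DERIV_sum *)
    also have "(\<Sum>j\<le>k. (-1) ^ j * of_nat (k choose j) *
        ((bspline (N - Suc k) (2 * y + c - real j) - bspline (N - Suc k) (2 * y + c - real (Suc j))) * 2)) =
        2 * (\<Sum>j\<le>Suc k. (-1) ^ j * of_nat (Suc k choose j) * bspline (N - Suc k) (2 * y + c - real j))"
      unfolding alternating_binomial_sum_diff[symmetric] sum_distrib_left
      by (intro sum.cong) (simp_all add: algebra_simps del: bspline.simps)
    finally show ?thesis by (simp add: F_def mult.assoc mult.left_commute del: bspline.simps sum.atMost_Suc)
  qed
  have F: "(deriv ^^ k) (\<lambda>y. bspline N (2 * y + c)) = F k" if "k < N" for k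
    using that
  proof (induction k)
    case 0
    show ?case by (simp add: F_def)
  next
    case (Suc k)
    then have "(deriv ^^ Suc k) (\<lambda>y. bspline N (2 * y + c)) = deriv (F k)" by simp
    also have "\<dots> = F (Suc k)"
      using DERIV_imp_deriv[OF deriv_F[OF Suc.prems]] by blast
    finally show ?case .
  qed
  show "(deriv ^^ k) (\<lambda>y. bspline N (2 * y + c)) =
    (\<lambda>y. 2 ^ k * (\<Sum>j\<le>k. (-1) ^ j * of_nat (k choose j) * bspline (N - k) (2 * y + c - real j)))"
    using F[OF assms] by (simp add: F_def del: bspline.simps)
  show "(deriv ^^ k) (\<lambda>y. bspline N (2 * y + c)) differentiable (at x)" if "Suc k < N"
    using F[OF assms] deriv_F[OF that, of x] by (auto simp: real_differentiable_def)
qed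

lemma fourier_scale:
  assumes "c > 0"
  shows "fourier (\<lambda>x. f (c * x)) \<omega> = of_real (1 / c) * fourier f (\<omega> / c)"
proof -
  have "fourier f (\<omega> / c) = c *\<^sub>R (LBINT x. f (c * x) * cis (- (\<omega> * x)))"
    unfolding fourier_cis using assms by (subst lborel_integral_real_affine[of c _ 0]) simp_all
  then show ?thesis
    using assms by (simp add: fourier_cis scaleR_conv_of_real)
qed

subsection \<open>Scaling functions and wavelets\<close>

lemma gauss_pair_shift_op:
  assumes "gauss_pair f g"
  shows "gauss_pair (shift_op a h f) (\<lambda>\<omega>. (1 + of_real a * cis (h * \<omega>)) * g \<omega>)"
  using gauss_pair_add[OF assms gauss_pair_cmult[OF gauss_pair_shift[OF assms, of h], of "of_real a"]]
  by (simp add: shift_op_def algebra_simps)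

text \<open>Multipliers commute, so the order of composition fixed by the sorted list leaves no
  trace in the product over \<open>A\<close>.\<close>

lemma gauss_pair_fold:
  assumes "gauss_pair f g" and "finite A"
    and "\<And>j f g. gauss_pair f g \<Longrightarrow> gauss_pair (Op j f) (\<lambda>\<omega>. m j \<omega> * g \<omega>)"
  shows "gauss_pair (fold Op (sorted_list_of_set A) f) (\<lambda>\<omega>. (\<Prod>j\<in>A. m j \<omega>) * g \<omega>)"
proof -
  have "gauss_pair (fold Op xs f) (\<lambda>\<omega>. (\<Prod>j\<in>set xs. m j \<omega>) * g \<omega>)" if "distinct xs" for xs
    using assms(1) that
  proof (induction xs arbitrary: f g)
    case (Cons x xs)
    from Cons.IH[OF assms(3)[OF Cons.prems(1), of x]] Cons.prems(2) show ?case
      by (simp add: mult_ac)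
  qed simp
  from this[of "sorted_list_of_set A"] assms(2) show ?thesis by simp
qed

lemma gauss_pair_sum:
  assumes "finite A" and "\<And>i. i \<in> A \<Longrightarrow> gauss_pair (f i) (g i)"
  shows "gauss_pair (\<lambda>x. \<Sum>i\<in>A. f i x) (\<lambda>\<omega>. \<Sum>i\<in>A. g i \<omega>)"
  using assms
proof (induction A rule: finite_induct)
  case empty
  show ?case by (simp add: gauss_pair_def)
next
  case (insert a A)
  then show ?case using gauss_pair_add[of "f a" "g a"] by simp
qed

lemma gauss_pair_bspline:
  assumes "n \<ge> 1"
  shows "gauss_pair (\<lambda>x. of_real (bspline n x)) (bspline_hat n)"
  unfolding bspline_hat_def
  using continuous_on_bspline[OF assms] integrable_bspline
  by (intro gauss_pair_fourier continuous_intros) auto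

lemma gauss_pair_bspline_dilate:
  assumes "n \<ge> 1"
  shows "gauss_pair (\<lambda>x. of_real (bspline n (2 * x + c)))
    (\<lambda>\<omega>. cis (c / 2 * \<omega>) * (of_real (1 / 2) * bspline_hat n (\<omega> / 2)))"
proof -
  have "gauss_pair (\<lambda>x. of_real (bspline n (2 * x))) (fourier (\<lambda>x. of_real (bspline n (2 * x))))"
  proof (intro gauss_pair_fourier)
    show "complex_integrable lborel (\<lambda>x. of_real (bspline n (2 * x)))"
      using lborel_integrable_real_affine[OF integrable_bspline, of 2 n 0] by simp
    show "continuous_on UNIV (\<lambda>x. complex_of_real (bspline n (2 * x)))"
      by (intro continuous_intros continuous_on_compose2[OF continuous_on_bspline[OF assms, of UNIV]]) auto
  qed
  also have "fourier (\<lambda>x. of_real (bspline n (2 * x))) = (\<lambda>\<omega>. of_real (1 / 2) * bspline_hat n (\<omega> / 2))"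
    using fourier_scale[of 2 "\<lambda>x. of_real (bspline n x)"] by (simp add: bspline_hat_def fun_eq_iff)
  \<comment> \<open>Since \<open>2 * (x + c / 2) = 2 * x + c\<close>, the constant \<open>c\<close>
    is a shift by \<open>c / 2\<close> of the dilated spline.\<close>
  finally show ?thesis
    using gauss_pair_shift[of _ _ "c / 2"] by (fastforce simp: algebra_simps)
qed

text \<open>Both bounds come from \<open>(a - 1)^2 < a * (a - 1) < (a - 1/2)^2\<close> by taking
  square roots.\<close>

lemma r_of_bounds:
  assumes "\<alpha> j > 1"
  shows "0 < r_of \<alpha> j" "r_of \<alpha> j < 1"
proof -
  define a where "a = \<alpha> j"
  have a: "a > 1" using assms by (simp add: a_def)
  have "sqrt (a * (a - 1)) < sqrt ((a - 1 / 2)\<^sup>2)"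
    by (rule real_sqrt_less_mono) (simp add: power2_eq_square algebra_simps)
  then show "0 < r_of \<alpha> j" using a by (simp add: r_of_def a_def)
  have "sqrt ((a - 1)\<^sup>2) < sqrt (a * (a - 1))"
    by (rule real_sqrt_less_mono) (use a in \<open>simp add: power2_eq_square algebra_simps\<close>)
  then show "r_of \<alpha> j < 1" using a by (simp add: r_of_def a_def)
qed

text \<open>A zero would force modulus 1 on a number of modulus \<open>r < 1\<close>. This keeps the
  denominators of \<open>phi_hat\<close> and \<open>psi_hat\<close> away from 0.\<close>

lemma one_plus_r_cis_nonzero:
  assumes "0 < r" "r < (1::real)"
  shows "1 + of_real r * cis t \<noteq> 0"
proof
  assume "1 + of_real r * cis t = 0"
  then have "of_real r * cis t = - 1" by (simp add: add_eq_0_iff)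
  then have "norm (of_real r * cis t) = 1" by simp
  then show False using assms by (simp add: norm_mult)
qed

section \<open>Products and sums over the choices of the tuple\<close>

lemma sqrt_prod: "sqrt (\<Prod>j\<in>A. f j) = (\<Prod>j\<in>A. sqrt (f j))"
  by (induction A rule: infinite_finite_induct) (simp_all add: real_sqrt_mult)

text \<open>As \<open>r j\<close> differs from its inverse, \<open>J_r\<close> and
  \<open>J_inv\<close> partition \<open>{1..n}\<close>, so the two products merge into one with a
  case distinction in each factor.\<close>

lemma prod_J:
  assumes "t \<in> choices n r" and "\<And>j. j \<in> {1..n} \<Longrightarrow> r j \<noteq> 1 / r j"
  shows "(\<Prod>j\<in>J_r n r t. f j) * (\<Prod>j\<in>J_inv n r t. g j) =
    (\<Prod>j=1..n. if t j = r j then f j else g j)"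
proof -
  have "J_r n r t = {1..n} \<inter> {j. t j = r j}" by (auto simp: J_r_def)
  moreover have "t j \<in> {r j, 1 / r j}" if "j \<in> {1..n}" for j
    using assms(1) that by (auto simp: choices_def)
  then have "J_inv n r t = {1..n} \<inter> - {j. t j = r j}"
    using assms(2) by (fastforce simp: J_inv_def)
  ultimately show ?thesis by (simp add: prod.If_cases)
qed

text \<open>Induction on \<open>j\<close> for arbitrary \<open>t\<close>, because a step of the
  recursion updates \<open>t\<close> at \<open>Suc j\<close>. The entries up to \<open>j\<close> are
  summed out and \<open>t\<close> supplies the rest.\<close>

lemma T_rec_sum:
  assumes "\<And>j. j \<in> {1..n} \<Longrightarrow> r j \<noteq> 1 / r j"
  defines "w \<equiv> \<lambda>j v. if v = r j then 1 / sqrt (r j) else - sqrt (r j)"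
  shows "j \<le> n \<Longrightarrow> T_rec r L j t x =
    (\<Sum>u\<in>choices j r. of_real (\<Prod>i=1..j. w i (u i)) * L (\<lambda>i. if i \<in> {1..j} then u i else t i) x)"
proof (induction j arbitrary: t)
  case 0
  show ?case by (simp add: choices_def)
next
  case (Suc j)
  let ?k = "Suc j"
  have ne: "r ?k \<noteq> 1 / r ?k" using assms(1)[of ?k] Suc.prems by simp
  \<comment> \<open>A tuple on \<open>{1..Suc j}\<close> is a last entry together with a tuple on
    \<open>{1..j}\<close>; the sum is reindexed along this bijection.\<close>
  have ch: "choices ?k r = (\<lambda>(y, g). g(?k := y)) ` ({r ?k, 1 / r ?k} \<times> choices j r)"
    unfolding choices_def by (subst PiE_insert_eq[symmetric]) (simp add: atLeastAtMostSuc_conv)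
  have inj: "inj_on (\<lambda>(y, g). g(?k := y)) ({r ?k, 1 / r ?k} \<times> choices j r)"
    unfolding choices_def
    using inj_combinator[of ?k "{1..j}" "\<lambda>i. {r i, 1 / r i}"] by simp
  have step: "of_real (\<Prod>i=1..?k. w i ((u(?k := v)) i)) * L (\<lambda>i. if i \<in> {1..?k} then (u(?k := v)) i else t i) x
     = of_real (w ?k v) * (of_real (\<Prod>i=1..j. w i (u i)) *
         L (\<lambda>i. if i \<in> {1..j} then u i else (t(?k := v)) i) x)" for u v
  proof -
    have "(\<lambda>i. if i \<in> {1..?k} then (u(?k := v)) i else t i) =
          (\<lambda>i. if i \<in> {1..j} then u i else (t(?k := v)) i)" by auto
    moreover have "(\<Prod>i=1..?k. w i ((u(?k := v)) i)) = w ?k v * (\<Prod>i=1..j. w i (u i))"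
      by (simp add: atLeastAtMostSuc_conv)
    ultimately show ?thesis by simp
  qed
  have "(\<Sum>u\<in>choices ?k r. of_real (\<Prod>i=1..?k. w i (u i)) * L (\<lambda>i. if i \<in> {1..?k} then u i else t i) x) =
    (\<Sum>(v, u)\<in>{r ?k, 1 / r ?k} \<times> choices j r. of_real (\<Prod>i=1..?k. w i ((u(?k := v)) i)) *
       L (\<lambda>i. if i \<in> {1..?k} then (u(?k := v)) i else t i) x)"
    unfolding ch by (subst sum.reindex[OF inj]) (simp add: case_prod_unfold)
  also have "\<dots> = (\<Sum>v\<in>{r ?k, 1 / r ?k}. \<Sum>u\<in>choices j r. of_real (w ?k v) * (of_real (\<Prod>i=1..j. w i (u i)) *
         L (\<lambda>i. if i \<in> {1..j} then u i else (t(?k := v)) i) x))"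
    unfolding step by (simp only: sum.cartesian_product)
  also have "\<dots> = (\<Sum>v\<in>{r ?k, 1 / r ?k}. of_real (w ?k v) * T_rec r L j (t(?k := v)) x)"
    using Suc by (simp add: sum_distrib_left)
  also have "\<dots> = T_rec r L ?k t x"
    using ne by (simp add: w_def)
  finally show ?case by simp
qed

lemma T_rec_eq_sum_choices:
  assumes "\<And>j. j \<in> {1..n} \<Longrightarrow> r j \<noteq> 1 / r j"
  shows "T_rec r L n (\<lambda>_. undefined) x =
    (\<Sum>t\<in>choices n r. of_real ((\<Prod>j\<in>J_r n r t. 1 / sqrt (r j)) * (\<Prod>j\<in>J_inv n r t. - sqrt (r j))) * L t x)"
proof -
  let ?w = "\<lambda>t. of_real (\<Prod>i=1..n. if t i = r i then 1 / sqrt (r i) else - sqrt (r i))"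
  have "T_rec r L n (\<lambda>_. undefined) x =
    (\<Sum>t\<in>choices n r. ?w t * L (\<lambda>i. if i \<in> {1..n} then t i else undefined) x)"
    by (rule T_rec_sum[of n r n]) (simp_all add: assms)
  also have "\<dots> = (\<Sum>t\<in>choices n r.
      of_real ((\<Prod>j\<in>J_r n r t. 1 / sqrt (r j)) * (\<Prod>j\<in>J_inv n r t. - sqrt (r j))) * L t x)"
  proof (intro sum.cong refl)
    fix t assume t: "t \<in> choices n r"
    \<comment> \<open>Tuples in \<open>choices\<close> are \<open>undefined\<close> outside
      \<open>{1..n}\<close>, so filling up with \<open>undefined\<close> gives back
      \<open>t\<close>.\<close>
    have e: "(\<lambda>i. if i \<in> {1..n} then t i else undefined) = t"
    proof
      show "(if i \<in> {1..n} then t i else undefined) = t i" for i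
        using t PiE_arb[of t "{1..n}" _ i] unfolding choices_def by auto
    qed
    show "?w t * L (\<lambda>i. if i \<in> {1..n} then t i else undefined) x =
      of_real ((\<Prod>j\<in>J_r n r t. 1 / sqrt (r j)) * (\<Prod>j\<in>J_inv n r t. - sqrt (r j))) * L t x"
      unfolding e by (subst prod_J[OF t]) (use assms in auto)
  qed
  finally show ?thesis .
qed

text \<open>Each summand is a product of functions of the single entries \<open>t j\<close>, so the
  sum over all tuples is the product of the two-term sums \<open>(1 / r j - z) - (r j - z)\<close>,
  from which \<open>z\<close> drops out.\<close>

lemma sum_choices_prod:
  assumes "\<And>j. j \<in> {1..n} \<Longrightarrow> 0 < r j \<and> r j < 1"
  shows "(\<Sum>t\<in>choices n r.
      of_real ((\<Prod>j\<in>J_r n r t. 1 / sqrt (r j)) * (\<Prod>j\<in>J_inv n r t. - sqrt (r j))) *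
      (of_real (\<Prod>j=1..n. sqrt (t j)) * (\<Prod>j=1..n. of_real (1 / t j) - z))) =
    (of_real (\<Prod>j=1..n. 1 / r j - r j) :: complex)"
proof -
  have ne: "r j \<noteq> 1 / r j" if "j \<in> {1..n}" for j
  proof -
    have "r j * r j < 1 * 1" using assms[OF that] by (intro mult_strict_mono) auto
    then show ?thesis using assms[OF that] by (auto simp: field_simps)
  qed
  define F where "F = (\<lambda>j v. of_real ((if v = r j then 1 / sqrt (r j) else - sqrt (r j)) * sqrt v)
     * (of_real (1 / v) - z))"
  have "(\<Sum>t\<in>choices n r.
      of_real ((\<Prod>j\<in>J_r n r t. 1 / sqrt (r j)) * (\<Prod>j\<in>J_inv n r t. - sqrt (r j))) *
      (of_real (\<Prod>j=1..n. sqrt (t j)) * (\<Prod>j=1..n. of_real (1 / t j) - z))) =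
    (\<Sum>t\<in>choices n r. \<Prod>j=1..n. F j (t j))"
  proof (intro sum.cong refl)
    fix t assume "t \<in> choices n r"
    from prod_J[OF this ne, of "\<lambda>j. 1 / sqrt (r j)" "\<lambda>j. - sqrt (r j)"]
    have W: "(\<Prod>j\<in>J_r n r t. 1 / sqrt (r j)) * (\<Prod>j\<in>J_inv n r t. - sqrt (r j)) =
       (\<Prod>j = 1..n. if t j = r j then 1 / sqrt (r j) else - sqrt (r j))" by simp
    show "of_real ((\<Prod>j\<in>J_r n r t. 1 / sqrt (r j)) * (\<Prod>j\<in>J_inv n r t. - sqrt (r j))) *
      (of_real (\<Prod>j=1..n. sqrt (t j)) * (\<Prod>j=1..n. of_real (1 / t j) - z)) = (\<Prod>j=1..n. F j (t j))"
      unfolding W F_def prod.distrib of_real_mult of_real_prod by (simp only: mult.assoc)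
  qed
  also have "\<dots> = (\<Prod>j=1..n. \<Sum>v\<in>{r j, 1 / r j}. F j v)"
    unfolding choices_def by (rule prod_sum_PiE[symmetric]) auto
  also have "\<dots> = (\<Prod>j=1..n. of_real (1 / r j - r j))"
  proof (intro prod.cong refl)
    fix j assume j: "j \<in> {1..n}"
    have r: "0 < r j" using assms[OF j] by simp
    \<comment> \<open>For the entry \<open>1 / r j\<close> the weight \<open>- sqrt (r j)\<close>
      meets the factor \<open>sqrt (1 / r j)\<close>, and only the sign survives.\<close>
    have "sqrt (r j) * sqrt (1 / r j) = 1"
      using r by (simp add: real_sqrt_mult[symmetric])
    moreover have "F j (1 / r j) = - of_real (sqrt (r j) * sqrt (1 / r j)) * (of_real (r j) - z)"
      using ne[OF j] by (simp add: F_def)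
    ultimately have F1: "F j (1 / r j) = - (of_real (r j) - z)" by simp
    have F2: "F j (r j) = of_real (1 / r j) - z" using r by (simp add: F_def)
    have "(\<Sum>v\<in>{r j, 1 / r j}. F j v) = F j (r j) + F j (1 / r j)"
      using ne[OF j] by simp
    then show "(\<Sum>v\<in>{r j, 1 / r j}. F j v) = of_real (1 / r j - r j)"
      unfolding F1 F2 by simp
  qed
  finally show ?thesis by simp
qed

lemma finite_choices: "finite (choices n r)"
  unfolding choices_def by (intro finite_PiE) auto

section \<open>Transforms after application of the operators\<close>

lemma finite_J [simp]: "finite (J_r n r t)" "finite (J_inv n r t)"
  by (simp_all add: J_r_def J_inv_def)

lemma borel_measurable_bspline_hat [measurable]: "bspline_hat n \<in> borel_measurable borel"
  unfolding bspline_hat_def by measurable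

text \<open>The multiplier \<open>P\<close> of the operators over \<open>J_r\<close> and the
  multiplier \<open>Q\<close> of those over \<open>J_inv\<close> are exactly the two denominators of
  \<open>phi_hat\<close>.\<close>

lemma gauss_pair_Phi:
  assumes "\<And>j. j \<in> {1..n} \<Longrightarrow> \<alpha> j > 1" and "scaling_function n \<alpha> s t \<phi>"
  shows "gauss_pair (Phi n (r_of \<alpha>) s t \<phi>) (\<lambda>\<omega>. of_real (beta_const n \<alpha>) * bspline_hat n \<omega>)"
proof -
  let ?r = "r_of \<alpha>"
  define P where "P = (\<lambda>\<omega>. \<Prod>j\<in>J_r n ?r t. 1 + of_real (?r j) * cis (s * \<omega>))"
  define Q where "Q = (\<lambda>\<omega>. \<Prod>j\<in>J_inv n ?r t. 1 + of_real (?r j) * cis (- s * \<omega>))"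
  have hat: "phi_hat n \<alpha> s t \<omega> = of_real (beta_const n \<alpha>) * bspline_hat n \<omega> / (P \<omega> * Q \<omega>)" for \<omega>
    unfolding phi_hat_def P_def Q_def Let_def beta_const_def exp_minus_i_cis cis_conv_exp[symmetric]
    by (simp add: mult_ac add.commute)
  have nz: "P \<omega> \<noteq> 0" "Q \<omega> \<noteq> 0" for \<omega>
    using one_plus_r_cis_nonzero[OF r_of_bounds[of \<alpha>, OF assms(1)]]
    by (auto simp: P_def Q_def J_r_def J_inv_def simp del: mult_minus_left)
  \<comment> \<open>The relation \<open>has_L2_fourier\<close> does not assert measurability of the
    transform, so it is read off from the explicit formula.\<close>
  have [measurable]: "phi_hat n \<alpha> s t \<in> borel_measurable borel"
    unfolding hat[abs_def] P_def Q_def by measurable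
  have "gauss_pair \<phi> (phi_hat n \<alpha> s t)"
    using assms(2) by (intro gauss_pair_L2_fourier) (auto simp: scaling_function_def)
  then have "gauss_pair (Phi n ?r s t \<phi>) (\<lambda>\<omega>. P \<omega> * (Q \<omega> * phi_hat n \<alpha> s t \<omega>))"
    unfolding Phi_def P_def Q_def by (intro gauss_pair_fold gauss_pair_shift_op finite_J)
  also have "(\<lambda>\<omega>. P \<omega> * (Q \<omega> * phi_hat n \<alpha> s t \<omega>)) = (\<lambda>\<omega>. of_real (beta_const n \<alpha>) * bspline_hat n \<omega>)"
    using nz by (simp add: hat fun_eq_iff)
  finally show ?thesis .
qed

text \<open>The operators again cancel the denominators, here with two factors per index. What is
  left depends on \<open>t\<close> only through \<open>sqrt (t j)\<close> and
  \<open>1 / t j - z\<close>, the form summed in \<open>sum_choices_prod\<close>.\<close>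

lemma gauss_pair_Lam:
  assumes "\<And>j. j \<in> {1..n} \<Longrightarrow> \<alpha> j > 1" and "wavelet n \<alpha> s t \<psi>"
  shows "gauss_pair (Lam n (r_of \<alpha>) s t \<psi>) (\<lambda>\<omega>.
     of_real ((-1) ^ (n + 1) * sqrt (\<Prod>j=1..n. \<alpha> j * t j) * (\<Prod>j=1..n. r_of \<alpha> j) / 2) *
     ((\<Prod>j=1..n. of_real (1 / t j) - cis (- (s * \<omega> / 2))) *
      (\<Sum>k\<le>n+1. (-1) ^ k * of_nat ((n + 1) choose k) * cis ((real n - real k) / 2 * \<omega>)) *
      bspline_hat n (\<omega> / 2)))" (is "gauss_pair _ ?G")
proof -
  let ?r = "r_of \<alpha>"
  define P where "P = (\<lambda>\<omega>. \<Prod>j\<in>J_r n ?r t. (1 + of_real (?r j) * cis (- s * \<omega>)) * (1 + of_real (?r j) * cis (s / 2 * \<omega>)))"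
  define Q where "Q = (\<lambda>\<omega>. \<Prod>j\<in>J_inv n ?r t. (1 + of_real (?r j) * cis (s * \<omega>)) * (1 + of_real (?r j) * cis (- s / 2 * \<omega>)))"
  have e: "exp (of_real (real n - real k) * \<i> * of_real (\<omega> / 2)) = cis ((real n - real k) / 2 * \<omega>)" for k \<omega>
    by (simp add: cis_conv_exp mult_ac)
  have hat: "psi_hat n \<alpha> s t \<omega> = ?G \<omega> / (P \<omega> * Q \<omega>)" for \<omega>
    unfolding psi_hat_def Let_def e exp_minus_i_cis cis_conv_exp[symmetric] P_def Q_def atLeast0AtMost
    by (simp add: field_simps)
  have nz: "P \<omega> \<noteq> 0" "Q \<omega> \<noteq> 0" for \<omega>
    using one_plus_r_cis_nonzero[OF r_of_bounds[of \<alpha>, OF assms(1)]]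
    by (auto simp: P_def Q_def J_r_def J_inv_def simp del: mult_minus_left)
  have [measurable]: "psi_hat n \<alpha> s t \<in> borel_measurable borel"
    unfolding hat[abs_def] P_def Q_def by measurable
  have "gauss_pair \<psi> (psi_hat n \<alpha> s t)"
    using assms(2) by (intro gauss_pair_L2_fourier) (auto simp: wavelet_def)
  have op: "gauss_pair ((shift_op (?r j) h \<circ> shift_op (?r j) h') f)
      (\<lambda>\<omega>. ((1 + of_real (?r j) * cis (h * \<omega>)) * (1 + of_real (?r j) * cis (h' * \<omega>))) * g \<omega>)"
    if "gauss_pair f g" for j h h' f g
    using gauss_pair_shift_op[OF gauss_pair_shift_op[OF that]] by (simp add: mult.assoc)
  have "gauss_pair (Lam n ?r s t \<psi>) (\<lambda>\<omega>. P \<omega> * (Q \<omega> * psi_hat n \<alpha> s t \<omega>))"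
    unfolding Lam_def P_def Q_def
    by (intro gauss_pair_fold op finite_J \<open>gauss_pair \<psi> (psi_hat n \<alpha> s t)\<close>)
  also have "(\<lambda>\<omega>. P \<omega> * (Q \<omega> * psi_hat n \<alpha> s t \<omega>)) = ?G"
    using nz by (simp add: hat fun_eq_iff del: sum.atMost_Suc)
  finally show ?thesis .
qed

text \<open>Differentiation lowers the order \<open>2 * n + 1\<close> to \<open>n\<close>. Its
  factor \<open>2 ^ (n + 1)\<close> and the \<open>1 / 2\<close> from the dilation leave
  \<open>2 ^ n\<close>, and the difference steps become half-integer shifts.\<close>

lemma gauss_pair_bspline_derivative:
  assumes "n \<ge> 1"
  shows "gauss_pair (\<lambda>x. of_real ((deriv ^^ (n + 1)) (\<lambda>y. bspline (2 * n + 1) (2 * y + real n)) x))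
    (\<lambda>\<omega>. 2 ^ n * ((\<Sum>k\<le>n+1. (-1) ^ k * of_nat ((n + 1) choose k) * cis ((real n - real k) / 2 * \<omega>)) *
       bspline_hat n (\<omega> / 2)))"
proof -
  have "gauss_pair (\<lambda>x. 2 ^ (n + 1) * (\<Sum>k\<le>n+1. ((-1) ^ k * of_nat ((n + 1) choose k)) *
      of_real (bspline n (2 * x + (real n - real k)))))
    (\<lambda>\<omega>. 2 ^ (n + 1) * (\<Sum>k\<le>n+1. ((-1) ^ k * of_nat ((n + 1) choose k)) *
      (cis ((real n - real k) / 2 * \<omega>) * (of_real (1 / 2) * bspline_hat n (\<omega> / 2)))))"
    using assms by (intro gauss_pair_cmult gauss_pair_sum gauss_pair_bspline_dilate) auto
  also have "(\<lambda>x. 2 ^ (n + 1) * (\<Sum>k\<le>n+1. ((-1) ^ k * of_nat ((n + 1) choose k)) *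
      of_real (bspline n (2 * x + (real n - real k))))) =
    (\<lambda>x. of_real ((deriv ^^ (n + 1)) (\<lambda>y. bspline (2 * n + 1) (2 * y + real n)) x) :: complex)"
    using assms by (subst bspline_iterated_derivative(1))
      (simp_all add: add_diff_eq del: sum.atMost_Suc bspline.simps)
  also have "(\<lambda>\<omega>. 2 ^ (n + 1) * (\<Sum>k\<le>n+1. ((-1) ^ k * of_nat ((n + 1) choose k)) *
      (cis ((real n - real k) / 2 * \<omega>) * (of_real (1 / 2) * bspline_hat n (\<omega> / 2))))) =
    (\<lambda>\<omega>. 2 ^ n * ((\<Sum>k\<le>n+1. (-1) ^ k * of_nat ((n + 1) choose k) * cis ((real n - real k) / 2 * \<omega>)) *
       bspline_hat n (\<omega> / 2)))"
    unfolding sum_distrib_left sum_distrib_right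
    by (intro ext sum.cong refl) simp
  finally show ?thesis .
qed

theorem theorem3p1:
  fixes n :: nat and \<alpha> r :: "nat \<Rightarrow> real" and s :: real
  assumes "n \<ge> 1"
    and "alpha_enumeration n \<alpha>"
    and "r = r_of \<alpha>"
    and "s = 1 \<or> s = -1"
  shows "(\<forall>t\<in>choices n r. \<forall>\<phi>. scaling_function n \<alpha> s t \<phi> \<longrightarrow>
            (\<forall>x. Phi n r s t \<phi> x = of_real (beta_const n \<alpha> * bspline n x)))
    \<and> (\<forall>\<psi>. (\<forall>t\<in>choices n r. wavelet n \<alpha> s t (\<psi> t)) \<longrightarrow>
          (\<forall>x. Psi n r s \<psi> x =
             (\<Sum>t\<in>choices n r.
                of_real ((\<Prod>j\<in>J_r n r t. 1 / sqrt (r j)) * (\<Prod>j\<in>J_inv n r t. - sqrt (r j)))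
                * Lam n r s t (\<psi> t) x))
        \<and> (\<forall>k\<le>n. \<forall>x. (deriv ^^ k) (\<lambda>y. bspline (2 * n + 1) (2 * y + real n)) differentiable (at x))
        \<and> (\<forall>x. Psi n r s \<psi> x =
             of_real (delta_const n \<alpha> * gamma_tilde n \<alpha> / 2 ^ (2 * n + 1)
               * (deriv ^^ (n + 1)) (\<lambda>y. bspline (2 * n + 1) (2 * y + real n)) x)))"
proof -
  have \<alpha>: "\<alpha> j > 1" if "j \<in> {1..n}" for j
    using assms(2) that by (auto simp: alpha_enumeration_def)
  have r: "0 < r j \<and> r j < 1" if "j \<in> {1..n}" for j
    using r_of_bounds[of \<alpha> j] \<alpha>[OF that] assms(3) by simp
  have ne: "r j \<noteq> 1 / r j" if "j \<in> {1..n}" for j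
  proof -
    have "r j < 1 / r j" using r[OF that] mult_strict_mono[of "r j" 1 "r j" 1] by (simp add: field_simps)
    then show ?thesis by simp
  qed
  \<comment> \<open>Both sides are continuous and paired with the same multiple of
    \<open>bspline_hat n\<close>, which gives equality at every point.\<close>
  have "Phi n r s t \<phi> = (\<lambda>x. of_real (beta_const n \<alpha>) * of_real (bspline n x))"
    if "scaling_function n \<alpha> s t \<phi>" for t \<phi>
    using gauss_pair_Phi[OF \<alpha> that] gauss_pair_cmult[OF gauss_pair_bspline[OF assms(1)]]
    unfolding assms(3) by (rule gauss_pair_unique)
  then have Phi: "Phi n r s t \<phi> x = of_real (beta_const n \<alpha> * bspline n x)"
    if "scaling_function n \<alpha> s t \<phi>" for t \<phi> x
    using that by (simp only: of_real_mult)
  have sum: "Psi n r s \<psi> x =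
      (\<Sum>t\<in>choices n r.
        of_real ((\<Prod>j\<in>J_r n r t. 1 / sqrt (r j)) * (\<Prod>j\<in>J_inv n r t. - sqrt (r j))) * Lam n r s t (\<psi> t) x)" for \<psi> x
    unfolding Psi_def by (rule T_rec_eq_sum_choices[OF ne])
  \<comment> \<open>\<open>deriv\<close> has a default value where no derivative exists;
    differentiability of the iterates up to order \<open>n\<close> certifies a genuine derivative of
    order \<open>n + 1\<close>. The bound \<open>Suc k < 2 * n + 1\<close> follows from
    \<open>k \<le> n\<close> and \<open>n \<ge> 1\<close>.\<close>
  have diff: "(deriv ^^ k) (\<lambda>y. bspline (2 * n + 1) (2 * y + real n)) differentiable (at x)" if "k \<le> n" for k x
    using that assms(1) by (intro bspline_iterated_derivative(2)) auto
  have "Psi n r s \<psi> = (\<lambda>x. of_real (delta_const n \<alpha> * gamma_tilde n \<alpha> / 2 ^ (2 * n + 1)) *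
       of_real ((deriv ^^ (n + 1)) (\<lambda>y. bspline (2 * n + 1) (2 * y + real n)) x))"
    if \<psi>: "\<forall>t\<in>choices n r. wavelet n \<alpha> s t (\<psi> t)" for \<psi>
  proof (rule gauss_pair_unique)
    let ?w = "\<lambda>t. complex_of_real ((\<Prod>j\<in>J_r n r t. 1 / sqrt (r j)) * (\<Prod>j\<in>J_inv n r t. - sqrt (r j)))"
    \<comment> \<open>\<open>c\<close> collects the constants of \<open>psi_hat\<close> that do not
      depend on the tuple, and \<open>D\<close> the factors common to all tuples.\<close>
    define c where "c = (-1) ^ (n + 1) * (\<Prod>j=1..n. sqrt (\<alpha> j)) * (\<Prod>j=1..n. r j) / 2"
    define D where "D = (\<lambda>\<omega>. (\<Sum>k\<le>n+1. (-1) ^ k * of_nat ((n + 1) choose k) * cis ((real n - real k) / 2 * \<omega>)) *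
       bspline_hat n (\<omega> / 2))"
    have "gauss_pair (Psi n r s \<psi>) (\<lambda>\<omega>. \<Sum>t\<in>choices n r. ?w t *
       (of_real ((-1) ^ (n + 1) * sqrt (\<Prod>j=1..n. \<alpha> j * t j) * (\<Prod>j=1..n. r j) / 2) *
       ((\<Prod>j=1..n. of_real (1 / t j) - cis (- (s * \<omega> / 2))) *
      (\<Sum>k\<le>n+1. (-1) ^ k * of_nat ((n + 1) choose k) * cis ((real n - real k) / 2 * \<omega>)) *
      bspline_hat n (\<omega> / 2))))"
      unfolding sum[abs_def] using \<psi> \<alpha> unfolding assms(3)
      by (intro gauss_pair_sum finite_choices gauss_pair_cmult gauss_pair_Lam) auto
    also have "(\<lambda>\<omega>. \<Sum>t\<in>choices n r. ?w t *
       (of_real ((-1) ^ (n + 1) * sqrt (\<Prod>j=1..n. \<alpha> j * t j) * (\<Prod>j=1..n. r j) / 2) *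
       ((\<Prod>j=1..n. of_real (1 / t j) - cis (- (s * \<omega> / 2))) *
      (\<Sum>k\<le>n+1. (-1) ^ k * of_nat ((n + 1) choose k) * cis ((real n - real k) / 2 * \<omega>)) *
      bspline_hat n (\<omega> / 2)))) = (\<lambda>\<omega>. of_real (delta_const n \<alpha> * c) * D \<omega>)"
    proof
      fix \<omega>
      define z where "z = cis (- (s * \<omega> / 2))"
      have "(\<Sum>t\<in>choices n r. ?w t *
         (of_real ((-1) ^ (n + 1) * sqrt (\<Prod>j=1..n. \<alpha> j * t j) * (\<Prod>j=1..n. r j) / 2) *
         ((\<Prod>j=1..n. of_real (1 / t j) - z) *
        (\<Sum>k\<le>n+1. (-1) ^ k * of_nat ((n + 1) choose k) * cis ((real n - real k) / 2 * \<omega>)) *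
        bspline_hat n (\<omega> / 2)))) =
        (\<Sum>t\<in>choices n r. of_real c * D \<omega> *
          (?w t * (of_real (\<Prod>j=1..n. sqrt (t j)) * (\<Prod>j=1..n. of_real (1 / t j) - z))))"
      proof (intro sum.cong refl)
        fix t
        have "sqrt (\<Prod>j=1..n. \<alpha> j * t j) = (\<Prod>j=1..n. sqrt (\<alpha> j)) * (\<Prod>j=1..n. sqrt (t j))"
          by (simp add: sqrt_prod real_sqrt_mult prod.distrib)
        then have "(-1) ^ (n + 1) * sqrt (\<Prod>j=1..n. \<alpha> j * t j) * (\<Prod>j=1..n. r j) / 2 =
            c * (\<Prod>j=1..n. sqrt (t j))" by (simp add: c_def)
        then show "?w t *
         (of_real ((-1) ^ (n + 1) * sqrt (\<Prod>j=1..n. \<alpha> j * t j) * (\<Prod>j=1..n. r j) / 2) *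
         ((\<Prod>j=1..n. of_real (1 / t j) - z) *
        (\<Sum>k\<le>n+1. (-1) ^ k * of_nat ((n + 1) choose k) * cis ((real n - real k) / 2 * \<omega>)) *
        bspline_hat n (\<omega> / 2))) = of_real c * D \<omega> *
          (?w t * (of_real (\<Prod>j=1..n. sqrt (t j)) * (\<Prod>j=1..n. of_real (1 / t j) - z)))"
          unfolding D_def by (simp only: of_real_mult mult_ac)
      qed
      \<comment> \<open>Here \<open>z\<close>, and with it the choice of sign \<open>s\<close>,
        disappears from the transform.\<close>
      also have "\<dots> = of_real (delta_const n \<alpha> * c) * D \<omega>"
        unfolding sum_distrib_left[symmetric]
        by (subst sum_choices_prod) (use r in \<open>auto simp: delta_const_def assms(3)\<close>)
      finally show "(\<Sum>t\<in>choices n r. ?w t *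
       (of_real ((-1) ^ (n + 1) * sqrt (\<Prod>j=1..n. \<alpha> j * t j) * (\<Prod>j=1..n. r j) / 2) *
       ((\<Prod>j=1..n. of_real (1 / t j) - cis (- (s * \<omega> / 2))) *
      (\<Sum>k\<le>n+1. (-1) ^ k * of_nat ((n + 1) choose k) * cis ((real n - real k) / 2 * \<omega>)) *
      bspline_hat n (\<omega> / 2)))) = of_real (delta_const n \<alpha> * c) * D \<omega>"
        unfolding z_def .
    qed
    finally show "gauss_pair (Psi n r s \<psi>) (\<lambda>\<omega>. of_real (delta_const n \<alpha> * c) * D \<omega>)" .
    \<comment> \<open>Dividing by the sign equals multiplying by it, whence the parity split. With
      \<open>2 ^ (2 * n + 1) = 2 ^ n * 2 ^ (n + 1)\<close> a factor \<open>1 / 2 ^ n\<close>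
      remains, which the \<open>2 ^ n\<close> in the transform of the derivative cancels.\<close>
    have "gamma_tilde n \<alpha> = 2 ^ (n + 1) * c"
      by (cases "even n") (simp_all add: gamma_tilde_def c_def sqrt_prod assms(3))
    then have "delta_const n \<alpha> * gamma_tilde n \<alpha> / 2 ^ (2 * n + 1) =
        delta_const n \<alpha> * (2 ^ (n + 1) * c) / (2 ^ n * 2 ^ (n + 1))"
      by (simp only: power_add[symmetric] mult_2 add.assoc)
    also have "\<dots> = delta_const n \<alpha> * c / 2 ^ n"
      by (simp only: mult.left_commute[of _ "2 ^ (n + 1)"] mult.commute[of "2 ^ n"]) (simp del: power_Suc)
    finally have K: "delta_const n \<alpha> * c = delta_const n \<alpha> * gamma_tilde n \<alpha> / 2 ^ (2 * n + 1) * 2 ^ n"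
      by (simp del: power_Suc)
    have "(\<lambda>\<omega>. of_real (delta_const n \<alpha> * gamma_tilde n \<alpha> / 2 ^ (2 * n + 1)) * (2 ^ n * D \<omega>)) =
          (\<lambda>\<omega>. of_real (delta_const n \<alpha> * c) * D \<omega>)"
      unfolding K of_real_mult[of _ "2 ^ n"] by (simp only: mult.assoc of_real_power of_real_numeral)
    then show "gauss_pair (\<lambda>x. of_real (delta_const n \<alpha> * gamma_tilde n \<alpha> / 2 ^ (2 * n + 1)) *
       of_real ((deriv ^^ (n + 1)) (\<lambda>y. bspline (2 * n + 1) (2 * y + real n)) x))
       (\<lambda>\<omega>. of_real (delta_const n \<alpha> * c) * D \<omega>)"
      using gauss_pair_cmult[OF gauss_pair_bspline_derivative[OF assms(1)],
        of "of_real (delta_const n \<alpha> * gamma_tilde n \<alpha> / 2 ^ (2 * n + 1))"]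
      unfolding D_def by (simp only:)
  qed
  then have Psi: "Psi n r s \<psi> x = of_real (delta_const n \<alpha> * gamma_tilde n \<alpha> / 2 ^ (2 * n + 1)
       * (deriv ^^ (n + 1)) (\<lambda>y. bspline (2 * n + 1) (2 * y + real n)) x)"
    if "\<forall>t\<in>choices n r. wavelet n \<alpha> s t (\<psi> t)" for \<psi> x
    using that by (simp only: of_real_mult)
  show ?thesis
    by (intro conjI allI ballI impI) (rule Phi sum diff Psi; assumption)+
qed

end
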